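(* Let $n\ge1$, $m\ge2$, and let $K$ be a multilinear Littlewood--Paley kernel of non-convolution type on $(\mathbb R^n)^{m+1}$ (as in the context) for which the operator $g'$ satisfies the standing boundedness assumption. For every $\vec f=(f_1,\dots,f_m)$ with each $f_i\in\mathrm{BMO}(\mathbb R^n)$, $g'(\vec f)$ is either infinite everywhere or finite almost everywhere, and in the latter case $$\big\|[g'(\vec f)]^2\big\|_{\mathrm{BLO}}\le C\prod_{i=1}^m\|f_i\|^2_{\mathrm{BMO}},\qquad \|g'(\vec f)\|_{\mathrm{BLO}}\le C\prod_{i=1}^m\|f_i\|_{\mathrm{BMO}},$$ with $C$ independent of $\vec f$.
   Context: A locally integrable function $K(x,y_1,\dots,y_m)$ defined away from the diagonal $x=y_1=\cdots=y_m$ in $(\mathbb R^n)^{m+1}$ is a multilinear Littlewood--Paley kernel of non-convolution type if: (1) for all $x$ and each $i$, $\int_{\mathbb R^n}K(x,y_1,\dots,y_m)\,dy_i=0$; (2) $|K(x,y_1,\dots,y_m)|\le C(1+\sum_{j}|y_j|)^{-(mn+\delta)}$ for some $C,\delta>0$; (3) for some $C,\gamma>0$: $|K(x,\dots,y_i,\dots)-K(x,\dots,y_i',\dots)|\le C|y_i-y_i'|^\gamma(1+\sum_j|x-y_j|)^{-(mn+\delta+\gamma)}$ whenever $2|y_i-y_i'|\le|x-y_i|$, and $|K(x,y_1,\dots,y_m)-K(x',y_1,\dots,y_m)|\le C|x-x'|^\gamma(1+\sum_j|x-y_j|)^{-(mn+\delta+\gamma)}$ whenever $2|x-x'|\le\max_j|x-y_j|$.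 For $t>0$, $K_t(x,y_1,\dots,y_m)=t^{-mn}K(x/t,y_1/t,\dots,y_m/t)$, $\mathcal{G}_t(\vec f)(x)=\int_{(\mathbb R^n)^m}K_t(x,y_1,\dots,y_m)\prod_if_i(y_i)\,dy_i$, and $g'(\vec f)(x)=(\int_0^\infty|\mathcal{G}_t(\vec f)(x)|^2dt/t)^{1/2}$. Standing assumption: $g'$ is bounded $L^{q_1}\times\cdots\times L^{q_m}\to L^q$ for some $1\le q_i<\infty$, $0<q<\infty$, $1/q=\sum1/q_i$. $\|f\|_{\mathrm{BMO}}=\sup_B\frac1{|B|}\int_B|f-f_B|$. $\|F\|_{\mathrm{BLO}}$ is the least $C$ with $\frac1{|B|}\int_B[F-\operatorname{ess\,inf}_BF]\le C$ for all balls $B$. *)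

theory Defs
  imports "HOL-Analysis.Analysis"
begin

text \<open>R^n is an arbitrary euclidean space 'a (n = DIM('a)); an m-tuple
(y_1,...,y_m) is a function y :: nat => 'a, extensional on {..<m}, with the
product Lebesgue measure.\<close>

abbreviation tuple_measure :: "nat \<Rightarrow> (nat \<Rightarrow> 'a::euclidean_space) measure" where
  "tuple_measure m \<equiv> Pi\<^sub>M {..<m} (\<lambda>_. lborel)"

definition off_diag :: "nat \<Rightarrow> 'a::euclidean_space \<Rightarrow> (nat \<Rightarrow> 'a) \<Rightarrow> bool" where
  "off_diag m x y \<longleftrightarrow> \<not> (\<forall>j<m. y j = x)"

definition LP_kernel :: "nat \<Rightarrow> ('a::euclidean_space \<Rightarrow> (nat \<Rightarrow> 'a) \<Rightarrow> real) \<Rightarrow> bool" where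
  "LP_kernel m K \<longleftrightarrow>
     (\<lambda>(x, y). K x y) \<in> borel_measurable (lborel \<Otimes>\<^sub>M tuple_measure m) \<and>
     (\<forall>R. set_integrable (lborel \<Otimes>\<^sub>M tuple_measure m)
             {(x, y). norm x \<le> R \<and> (\<forall>j<m. norm (y j) \<le> R)} (\<lambda>(x, y). K x y)) \<and>
     (\<exists>\<delta>>0. \<exists>\<gamma>>0. \<exists>C>0.
       \<comment> \<open>(1) cancellation in each variable\<close>
       (\<forall>x y i. y \<in> extensional {..<m} \<longrightarrow> i < m \<longrightarrow>
          integrable lborel (\<lambda>z. K x (y(i := z))) \<and>
          integral\<^sup>L lborel (\<lambda>z. K x (y(i := z))) = 0) \<and>
       \<comment> \<open>(2) size condition\<close>
       (\<forall>x y. y \<in> extensional {..<m} \<longrightarrow> off_diag m x y \<longrightarrow>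
          \<bar>K x y\<bar> \<le> C * (1 + (\<Sum>j<m. norm (y j))) powr (- (real m * DIM('a) + \<delta>))) \<and>
       \<comment> \<open>(3) smoothness in each y_i\<close>
       (\<forall>x y i y'. y \<in> extensional {..<m} \<longrightarrow> i < m \<longrightarrow>
          2 * norm (y i - y') \<le> norm (x - y i) \<longrightarrow>
          \<bar>K x y - K x (y(i := y'))\<bar> \<le>
            C * norm (y i - y') powr \<gamma> *
            (1 + (\<Sum>j<m. norm (x - y j))) powr (- (real m * DIM('a) + \<delta> + \<gamma>))) \<and>
       \<comment> \<open>(3) smoothness in x\<close>
       (\<forall>x x' y. y \<in> extensional {..<m} \<longrightarrow>
          2 * norm (x - x') \<le> Max ((\<lambda>j. norm (x - y j)) ` {..<m}) \<longrightarrow>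
          \<bar>K x y - K x' y\<bar> \<le>
            C * norm (x - x') powr \<gamma> *
            (1 + (\<Sum>j<m. norm (x - y j))) powr (- (real m * DIM('a) + \<delta> + \<gamma>))))"

definition dil_kernel ::
  "nat \<Rightarrow> ('a::euclidean_space \<Rightarrow> (nat \<Rightarrow> 'a) \<Rightarrow> real) \<Rightarrow> real \<Rightarrow> 'a \<Rightarrow> (nat \<Rightarrow> 'a) \<Rightarrow> real" where
  "dil_kernel m K t x y =
     t powr (- (real m * DIM('a))) * K (x /\<^sub>R t) (restrict (\<lambda>i. y i /\<^sub>R t) {..<m})"

definition LP_G ::
  "nat \<Rightarrow> ('a::euclidean_space \<Rightarrow> (nat \<Rightarrow> 'a) \<Rightarrow> real) \<Rightarrow> real \<Rightarrow> (nat \<Rightarrow> 'a \<Rightarrow> real) \<Rightarrow> 'a \<Rightarrow> real" where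
  "LP_G m K t f x =
     (\<integral>y. dil_kernel m K t x y * (\<Prod>i<m. f i (y i)) \<partial>tuple_measure m)"

definition LP_g_sq ::
  "nat \<Rightarrow> ('a::euclidean_space \<Rightarrow> (nat \<Rightarrow> 'a) \<Rightarrow> real) \<Rightarrow> (nat \<Rightarrow> 'a \<Rightarrow> real) \<Rightarrow> 'a \<Rightarrow> ennreal" where
  "LP_g_sq m K f x =
     (\<integral>\<^sup>+ t. indicator {0<..} t * ennreal ((LP_G m K t f x)\<^sup>2 / t) \<partial>lborel)"

definition LP_g ::
  "nat \<Rightarrow> ('a::euclidean_space \<Rightarrow> (nat \<Rightarrow> 'a) \<Rightarrow> real) \<Rightarrow> (nat \<Rightarrow> 'a \<Rightarrow> real) \<Rightarrow> 'a \<Rightarrow> ennreal" where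
  "LP_g m K f x =
     (if LP_g_sq m K f x = \<infinity> then \<infinity> else ennreal (sqrt (enn2real (LP_g_sq m K f x))))"

definition in_Lp :: "real \<Rightarrow> ('a::euclidean_space \<Rightarrow> real) \<Rightarrow> bool" where
  "in_Lp p f \<longleftrightarrow> f \<in> borel_measurable lborel \<and> integrable lborel (\<lambda>x. \<bar>f x\<bar> powr p)"

definition Lp_norm :: "real \<Rightarrow> ('a::euclidean_space \<Rightarrow> real) \<Rightarrow> real" where
  "Lp_norm p f = (\<integral>x. \<bar>f x\<bar> powr p \<partial>lborel) powr (1 / p)"

definition g_bounded :: "nat \<Rightarrow> ('a::euclidean_space \<Rightarrow> (nat \<Rightarrow> 'a) \<Rightarrow> real) \<Rightarrow> bool" where
  "g_bounded m K \<longleftrightarrow>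
     (\<exists>qs :: nat \<Rightarrow> real. \<exists>q :: real. \<exists>A :: real.
        (\<forall>i<m. 1 \<le> qs i) \<and> 0 < q \<and> 1 / q = (\<Sum>i<m. 1 / qs i) \<and>
        (\<forall>f :: nat \<Rightarrow> 'a \<Rightarrow> real. (\<forall>i<m. in_Lp (qs i) (f i)) \<longrightarrow>
           (AE x in lborel. LP_g m K f x \<noteq> \<infinity>) \<and>
           (\<integral>\<^sup>+ x. ennreal (enn2real (LP_g m K f x) powr q) \<partial>lborel)
             \<le> ennreal ((A * (\<Prod>i<m. Lp_norm (qs i) (f i))) powr q)))"

definition ball_avg :: "('a::euclidean_space \<Rightarrow> real) \<Rightarrow> 'a \<Rightarrow> real \<Rightarrow> real" where
  "ball_avg f c r = (\<integral>x\<in>ball c r. f x \<partial>lborel) / measure lborel (ball c r)"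

definition in_BMO :: "('a::euclidean_space \<Rightarrow> real) \<Rightarrow> bool" where
  "in_BMO f \<longleftrightarrow>
     (\<forall>c r. 0 < r \<longrightarrow> set_integrable lborel (ball c r) f) \<and>
     bdd_above {ball_avg (\<lambda>x. \<bar>f x - ball_avg f c r\<bar>) c r | c r. 0 < r}"

definition BMO_norm :: "('a::euclidean_space \<Rightarrow> real) \<Rightarrow> real" where
  "BMO_norm f = Sup {ball_avg (\<lambda>x. \<bar>f x - ball_avg f c r\<bar>) c r | c r. 0 < r}"

definition ess_inf_on :: "'a::euclidean_space set \<Rightarrow> ('a \<Rightarrow> real) \<Rightarrow> ereal" where
  "ess_inf_on B F = Sup {z :: ereal. AE x in lborel. x \<in> B \<longrightarrow> z \<le> ereal (F x)}"

definition BLO_bound :: "('a::euclidean_space \<Rightarrow> real) \<Rightarrow> real \<Rightarrow> bool" where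
  "BLO_bound F C \<longleftrightarrow>
     (\<forall>c r. 0 < r \<longrightarrow>
        set_integrable lborel (ball c r) F \<and> ess_inf_on (ball c r) F \<noteq> -\<infinity> \<and>
        ball_avg (\<lambda>x. F x - real_of_ereal (ess_inf_on (ball c r) F)) c r \<le> C)"

definition in_BLO :: "('a::euclidean_space \<Rightarrow> real) \<Rightarrow> bool" where
  "in_BLO F \<longleftrightarrow> (\<exists>C. BLO_bound F C)"

definition BLO_norm :: "('a::euclidean_space \<Rightarrow> real) \<Rightarrow> real" where
  "BLO_norm F = Inf {C. BLO_bound F C}"

end

theory Submission
  imports Defs
begin

text \<open>The size condition decays in \<open>y\<close> without reference to \<open>x\<close>. Together with the smoothness in \<open>y\<close>
  this forces decay in \<open>x\<close> as well: \<open>\<bar>K x y\<bar>\<close> is at most a constant times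
  \<open>(1 + \<bar>x\<bar> + \<Sum>\<bar>y\<^sub>j\<bar>)\<close> to the power \<open>-(mn + \<delta>)\<close>. By cancellation each \<open>f\<^sub>i\<close> may be replaced by
  \<open>f\<^sub>i\<close> minus its mean over a ball centred at the origin, so with \<open>P\<close> the product of the BMO norms,
  \<open>\<bar>G\<^sub>t f x\<bar>\<close> is at most \<open>C P\<close> times the \<open>\<delta>\<close>-th power of \<open>t / (t + \<bar>x\<bar>)\<close>, and the smoothness in \<open>x\<close> makes
  \<open>\<bar>G\<^sub>t f x - G\<^sub>t f 0\<bar>\<close> at most \<open>C P\<close> times a positive power of \<open>\<bar>x\<bar> / t\<close> for \<open>\<bar>x\<bar> \<le> t\<close>. Hence the
  square of \<open>g'(f)\<close> at \<open>x\<close> differs by \<open>O(P\<^sup>2)\<close> from the integral of \<open>\<bar>G\<^sub>t f 0\<bar>\<^sup>2 dt/t\<close> over \<open>t > \<bar>x\<bar>\<close>,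
  a decreasing function of \<open>\<bar>x\<bar>\<close> that grows at most like \<open>P\<^sup>2 log (1 / \<bar>x\<bar>)\<close>.\<close>

text \<open>Since the size condition decays in \<open>y\<close> and not in \<open>x - y\<close>, the
  origin is singled out: all means are taken over balls about 0, and an arbitrary
  \<open>ball c r\<close> is handled through the ball about 0 of radius
  \<open>s = norm c + r\<close> that contains it. BLO asks only for an upper bound against an
  essential infimum, and a function decreasing in \<open>norm x\<close> supplies that infimum at the
  rim \<open>norm x = s\<close>: the tail at the rim bounds the square function below up to
  \<open>O(P^2)\<close>, and the excess is at most \<open>O(P^2)\<close> times
  \<open>2 + ln (s / norm x)\<close>, whose mean over \<open>ball c r\<close> is bounded uniformly
  in \<open>c\<close> and \<open>r\<close>.

  For the multilinear estimates the joint power of exponent \<open>mn + e\<close> is split evenly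
  over the variables, so that Tonelli leaves one-variable weights of exponent
  \<open>n + e/m\<close>. These have bounded mass at every scale and tolerate the linear drift of
  BMO means over dyadic balls; this is why a single constant serves all \<open>x\<close> and
  \<open>t\<close>.\<close>

section \<open>Power weights\<close>

text \<open>Equal to \<open>s^(-n) * (1 + |y| / s)^(-(n + e))\<close> for \<open>s > 0\<close>: the
  L^1-normalised dilate of one profile, so its mass does not depend on \<open>s\<close>.\<close>

definition wt :: "real \<Rightarrow> real \<Rightarrow> 'a::euclidean_space \<Rightarrow> real" where
  "wt e s y = s powr e * (s + norm y) powr (- (real DIM('a) + e))"

lemma wt_nonneg: "0 \<le> wt e s y"
  by (simp add: wt_def)

lemma wt_measurable [measurable]: "wt e s \<in> borel_measurable borel"
  unfolding wt_def[abs_def] by measurable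

lemma measure_ball_lborel:
  "0 \<le> r \<Longrightarrow> measure lborel (ball c r) = unit_ball_vol (real DIM('a)) * r ^ DIM('a)"
  for c :: "'a::euclidean_space"
  using content_ball[of r c] by simp

lemma term_le_suminf_ennreal: "f k \<le> (\<Sum>k. f k)" for f :: "nat \<Rightarrow> ennreal"
  using sum_le_suminf[OF summableI, of "{k}" f] by simp

text \<open>Decompose dyadically: where \<open>norm y\<close> is of size \<open>2^k s\<close> the
  weight is about \<open>2^(-k e)\<close> divided by the volume of \<open>ball 0 (2^k s)\<close>.
  The hypothesis lets averages over these balls grow linearly in \<open>k\<close>, as means of a BMO
  function may, and \<open>(k + 1) * 2^(-k e)\<close> is still summable. All powers of
  \<open>s\<close> cancel, which makes \<open>C\<close> uniform in the scale.\<close>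

lemma nn_integral_wt_le:
  fixes e :: real
  assumes e: "0 < e"
  obtains C where "0 \<le> C"
    "\<And>s b (u::'a::euclidean_space \<Rightarrow> real). 0 < s \<Longrightarrow> 0 \<le> b \<Longrightarrow> u \<in> borel_measurable borel \<Longrightarrow> (\<And>y. 0 \<le> u y) \<Longrightarrow>
      (\<And>k. (\<integral>\<^sup>+ y. ennreal (indicator (ball 0 (2^k * s)) y * u y) \<partial>lborel)
          \<le> ennreal (b * real (Suc k) * measure lborel (ball (0::'a) (2^k * s)))) \<Longrightarrow>
      (\<integral>\<^sup>+ y. ennreal (wt e s y * u y) \<partial>lborel) \<le> ennreal (C * b)"
proof -
  define n where "n = DIM('a)"
  define V where "V = unit_ball_vol (real n)"
  define q where "q = (2::real) powr (- e)"
  define D where "D = 2 powr (real n + e) * V"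
  have q: "0 < q" "q < 1" using e by (auto simp: q_def powr_less_one)
  have V: "0 \<le> V" by (simp add: V_def)
  have D: "0 \<le> D" by (simp add: D_def V)
  define c where "c k = D * (real (Suc k) * q ^ k)" for k
  have "summable (\<lambda>k. real (Suc k) * q ^ k)"
    using geometric_deriv_sums[of q] q by (auto simp: sums_iff)
  then have sc: "summable c" unfolding c_def by (rule summable_mult)
  have c0: "0 \<le> c k" for k using q D by (simp add: c_def)
  show ?thesis
  proof (rule that[of "suminf c"])
    show "0 \<le> suminf c" by (rule suminf_nonneg[OF sc c0])
    fix s b :: real and u :: "'a \<Rightarrow> real"
    assume s: "0 < s" and b: "0 \<le> b" and um: "u \<in> borel_measurable borel" and u0: "\<And>y. 0 \<le> u y"
      and bd: "\<And>k. (\<integral>\<^sup>+ y. ennreal (indicator (ball 0 (2^k * s)) y * u y) \<partial>lborel)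
          \<le> ennreal (b * real (Suc k) * measure lborel (ball (0::'a) (2^k * s)))"
    define a where "a k = s powr e * (2^k * s / 2) powr (- (real n + e))" for k :: nat
    have a0: "0 \<le> a k" for k by (simp add: a_def)
    have pt: "ennreal (wt e s y * u y) \<le> (\<Sum>k. ennreal (a k) * ennreal (indicator (ball 0 (2^k * s)) y * u y))" for y
    proof -
      obtain k0 where k0: "norm y / s < 2 ^ k0" using real_arch_pow[of 2 "norm y / s"] by auto
      \<comment> \<open>The smallest dyadic ball containing \<open>y\<close>: minimality gives
        \<open>s + norm y >= 2^k s / 2\<close>, and the summand \<open>s\<close> covers the case
        \<open>k = 0\<close>.\<close>
      define k where "k = (LEAST k. norm y / s < 2 ^ k)"
      have k: "norm y / s < 2 ^ k" unfolding k_def by (rule LeastI[of _ k0], rule k0)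
      have le: "2 ^ k * s / 2 \<le> s + norm y"
      proof (cases k)
        case 0 then show ?thesis using s by (simp add: add_increasing2)
      next
        case (Suc j)
        then have "\<not> norm y / s < 2 ^ j" unfolding k_def using not_less_Least by (metis lessI)
        then show ?thesis using s Suc by (simp add: field_simps)
      qed
      have "wt e s y \<le> a k"
        unfolding wt_def a_def n_def
        using le s e by (intro mult_left_mono powr_mono2') auto
      then have "wt e s y * u y \<le> a k * (indicator (ball 0 (2^k * s)) y * u y)"
        using k s mult_right_mono[OF _ u0, of "wt e s y" "a k" y] by (simp add: field_simps)
      then have "ennreal (wt e s y * u y) \<le> ennreal (a k) * ennreal (indicator (ball 0 (2^k * s)) y * u y)"
        unfolding ennreal_mult'[OF a0, symmetric] by (rule ennreal_leI)
      also have "\<dots> \<le> (\<Sum>k. ennreal (a k) * ennreal (indicator (ball 0 (2^k * s)) y * u y))"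
        by (rule term_le_suminf_ennreal)
      finally show ?thesis .
    qed
    have coeff: "ennreal (a k) * ennreal (b * real (Suc k) * measure lborel (ball (0::'a) (2^k * s))) = ennreal (c k * b)" for k
    proof -
      have "(2^k * s / 2) powr (- (real n + e)) = (2^k * s) powr (- (real n + e)) * 2 powr (real n + e)"
        using s by (simp only: powr_divide powr_minus inverse_eq_divide) simp
      also have "(2^k * s) powr (- (real n + e)) = (2^k * s) powr (-e) * (2^k * s) powr (- real n)"
        using powr_add[of "2^k * s" "-e" "-real n"] by (simp add: add.commute)
      also have "(2^k * s) powr (- real n) = inverse ((2^k * s) ^ n)"
        using s by (simp add: powr_minus powr_realpow)
      also have "(2^k * s) powr (-e) = (2^k) powr (-e) * s powr (-e)"
        by (rule powr_mult)
      finally have eq1: "(2^k * s / 2) powr (- (real n + e)) = 2 powr (real n + e) * (2^k) powr (- e) * s powr (-e) * inverse ((2^k * s) ^ n)"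
        by (simp only: mult_ac)
      have eq2: "(2^k) powr (- e) = q ^ k"
        by (simp add: q_def powr_powr powr_realpow[symmetric] mult.commute)
      define P where "P = (2^k * s) ^ n"
      have P: "P * inverse P = 1" using s by (simp add: P_def)
      have eq3: "s powr e * s powr - e = 1" using s by (simp add: powr_add[symmetric])
      have eq4: "measure lborel (ball (0::'a) (2^k * s)) = V * P"
        using s by (simp add: measure_ball_lborel V_def n_def P_def)
      have "a k * (b * real (Suc k) * measure lborel (ball (0::'a) (2^k * s)))
          = (s powr e * s powr - e) * (P * inverse P) * (c k * b)"
        unfolding a_def eq1 eq2 eq4 c_def D_def P_def[symmetric] by (simp only: mult_ac)
      then have "a k * (b * real (Suc k) * measure lborel (ball (0::'a) (2^k * s))) = c k * b"
        unfolding eq3 P by simp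
      then show ?thesis by (simp only: ennreal_mult'[OF a0, symmetric])
    qed
    have "(\<integral>\<^sup>+ y. ennreal (wt e s y * u y) \<partial>lborel) \<le>
       (\<integral>\<^sup>+ y. (\<Sum>k. ennreal (a k) * ennreal (indicator (ball 0 (2^k * s)) y * u y)) \<partial>lborel)"
      by (intro nn_integral_mono pt)
    also have "\<dots> = (\<Sum>k. ennreal (a k) * (\<integral>\<^sup>+ y. ennreal (indicator (ball 0 (2^k * s)) y * u y) \<partial>lborel))"
    proof -
      have "(\<lambda>y. ennreal (indicator (ball 0 (2^k * s)) y * u y)) \<in> borel_measurable lborel" for k :: nat
        using um by (intro measurable_compose[OF _ measurable_ennreal] borel_measurable_times borel_measurable_indicator) auto
      then show ?thesis by (subst nn_integral_suminf) (auto simp: nn_integral_cmult)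
    qed
    also have "\<dots> \<le> (\<Sum>k. ennreal (a k) * ennreal (b * real (Suc k) * measure lborel (ball (0::'a) (2^k * s))))"
      by (intro suminf_le mult_left_mono bd) auto
    also have "\<dots> = (\<Sum>k. ennreal (c k * b))" by (simp only: coeff)
    also have "\<dots> = ennreal (suminf c * b)"
      unfolding suminf_mult2[OF sc] by (intro suminf_ennreal2 summable_mult2 sc mult_nonneg_nonneg c0 b)
    finally show "(\<integral>\<^sup>+ y. ennreal (wt e s y * u y) \<partial>lborel) \<le> ennreal (suminf c * b)" .
  qed
qed

section \<open>BMO\<close>

lemma in_BMO_measurable:
  fixes f :: "'a::euclidean_space \<Rightarrow> real"
  assumes "in_BMO f" shows "f \<in> borel_measurable borel"
proof (rule borel_measurable_LIMSEQ_real)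
  fix k :: nat
  have "set_integrable lborel (ball 0 (real (Suc k))) f"
    using assms by (auto simp: in_BMO_def)
  then show "(\<lambda>x. indicator (ball 0 (real (Suc k))) x *\<^sub>R f x) \<in> borel_measurable borel"
    unfolding set_integrable_def by (auto dest: borel_measurable_integrable)
next
  fix x :: 'a
  obtain N :: nat where N: "norm x < real N" using reals_Archimedean2 by blast
  have "eventually (\<lambda>k. indicator (ball 0 (real (Suc k))) x *\<^sub>R f x = f x) sequentially"
    using eventually_ge_at_top[of N]
  proof eventually_elim
    case (elim k)
    then have "norm x < real (Suc k)" using N by linarith
    then show ?case by simp
  qed
  then show "(\<lambda>k. indicator (ball 0 (real (Suc k))) x *\<^sub>R f x) \<longlonglongrightarrow> f x"
    by (rule tendsto_eventually)
qed

lemma ball_avg_le_BMO_norm: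
  assumes "in_BMO f" "0 < r"
  shows "ball_avg (\<lambda>x. \<bar>f x - ball_avg f c r\<bar>) c r \<le> BMO_norm f"
  unfolding BMO_norm_def by (rule cSup_upper) (use assms in \<open>auto simp: in_BMO_def\<close>)

lemma ball_avg_nonneg: "(\<And>x. 0 \<le> f x) \<Longrightarrow> 0 \<le> ball_avg f c r"
  by (auto simp: ball_avg_def set_lebesgue_integral_def intro!: divide_nonneg_nonneg integral_nonneg_AE)

lemma BMO_norm_nonneg: "in_BMO f \<Longrightarrow> 0 \<le> BMO_norm f"
  using ball_avg_le_BMO_norm[of f 1 0] ball_avg_nonneg[of "\<lambda>x. \<bar>f x - ball_avg f 0 1\<bar>" 0 1] by simp

lemma set_integrable_const_ball: "set_integrable lborel (ball c r) (\<lambda>_. a::real)"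
  unfolding set_integrable_def
  using emeasure_lborel_ball_finite[of c r] by (intro integrable_scaleR_left) auto

lemma set_integral_const_ball: "(\<integral>x\<in>ball c r. a \<partial>lborel) = a * measure lborel (ball c r)" for a :: real
  unfolding set_lebesgue_integral_def using emeasure_lborel_ball_finite[of c r] by simp

lemma BMO_set_integrable:
  assumes "in_BMO f" "0 < r"
  shows "set_integrable lborel (ball c r) (\<lambda>x. \<bar>f x - a\<bar>)"
  using assms by (intro set_integrable_abs set_integral_diff set_integrable_const_ball) (auto simp: in_BMO_def)

lemma BMO_integral_le:
  assumes "in_BMO f" "0 < r"
  shows "(\<integral>x\<in>ball c r. \<bar>f x - ball_avg f c r\<bar> \<partial>lborel) \<le> BMO_norm f * measure lborel (ball c r)"
  using ball_avg_le_BMO_norm[OF assms, of c] assms content_ball_pos[of r c]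
  by (simp add: ball_avg_def[of "\<lambda>x. \<bar>f x - ball_avg f c r\<bar>"] field_simps)

text \<open>The integral of \<open>|f - f_(2B)|\<close> over the small ball is at most that over the
  double ball, whose volume is \<open>2^DIM('a)\<close> times larger.\<close>

lemma ball_avg_diff_le:
  fixes f :: "'a::euclidean_space \<Rightarrow> real"
  assumes f: "in_BMO f" and r: "0 < r"
  shows "\<bar>ball_avg f 0 r - ball_avg f 0 (2 * r)\<bar> \<le> 2 ^ DIM('a) * BMO_norm f"
proof -
  let ?B = "ball (0::'a) r" and ?a = "ball_avg f 0 (2 * r)"
  have m: "0 < measure lborel ?B" using r content_ball_pos[of r "0::'a"] by simp
  have int: "set_integrable lborel ?B f" using f r by (auto simp: in_BMO_def)
  have "measure lborel ?B * (ball_avg f 0 r - ?a) = (\<integral>x\<in>?B. f x \<partial>lborel) - (\<integral>x\<in>?B. ?a \<partial>lborel)"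
    using m by (simp add: ball_avg_def[of f 0 r] set_integral_const_ball field_simps)
  also have "\<dots> = (\<integral>x\<in>?B. f x - ?a \<partial>lborel)"
    using int set_integrable_const_ball by (subst set_integral_diff) auto
  finally have "measure lborel ?B * \<bar>ball_avg f 0 r - ?a\<bar> = \<bar>\<integral>x\<in>?B. f x - ?a \<partial>lborel\<bar>"
    using m by (metis abs_mult abs_of_pos)
  also have "\<dots> \<le> (\<integral>x\<in>?B. \<bar>f x - ?a\<bar> \<partial>lborel)"
    using set_integral_norm_bound[OF set_integral_diff(1)[OF int set_integrable_const_ball], of ?a] by simp
  also have "\<dots> \<le> (\<integral>x\<in>ball 0 (2 * r). \<bar>f x - ?a\<bar> \<partial>lborel)"
    using r BMO_set_integrable[OF f, of r 0 ?a] BMO_set_integrable[OF f, of "2 * r" 0 ?a]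
    unfolding set_integrable_def set_lebesgue_integral_def
    by (intro integral_mono) (auto simp: indicator_def)
  also have "\<dots> \<le> BMO_norm f * measure lborel (ball (0::'a) (2 * r))"
    using r f by (intro BMO_integral_le) auto
  also have "\<dots> = measure lborel ?B * (2 ^ DIM('a) * BMO_norm f)"
    using r by (simp add: measure_ball_lborel power_mult_distrib)
  finally show ?thesis using m by simp
qed

lemma ball_avg_dyadic_diff_le:
  fixes f :: "'a::euclidean_space \<Rightarrow> real"
  assumes "in_BMO f" "0 < r"
  shows "\<bar>ball_avg f 0 (2 ^ k * r) - ball_avg f 0 r\<bar> \<le> real k * (2 ^ DIM('a) * BMO_norm f)"
proof (induction k)
  case (Suc k)
  then show ?case using ball_avg_diff_le[OF assms(1), of "2 ^ k * r"] assms
    by (simp add: algebra_simps abs_if split: if_splits)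
qed simp

text \<open>On the ball of radius \<open>2^k s\<close> the mean of
  \<open>|f - ball_avg f 0 s|\<close> is at most one oscillation plus \<open>k\<close> dyadic
  changes of mean, hence linear in \<open>k\<close> and within reach of
  \<open>nn_integral_wt_le\<close>. The factor \<open>2^DIM('a)\<close> inherited from doubling the
  radius is at least 1, so the same \<open>C\<close> serves the plain mass.\<close>

lemma BMO_weighted:
  fixes e :: real
  assumes "0 < e"
  obtains C where "0 \<le> C"
    "\<And>s. 0 < s \<Longrightarrow> (\<integral>\<^sup>+ y. ennreal (wt e s (y::'a::euclidean_space)) \<partial>lborel) \<le> ennreal C"
    "\<And>s f. 0 < s \<Longrightarrow> in_BMO f \<Longrightarrow>
      (\<integral>\<^sup>+ y. ennreal (wt e s (y::'a::euclidean_space) * \<bar>f y - ball_avg f 0 s\<bar>) \<partial>lborel) \<le> ennreal (C * BMO_norm f)"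
proof -
  obtain C where C: "0 \<le> C"
    "\<And>s b (u::'a::euclidean_space \<Rightarrow> real). 0 < s \<Longrightarrow> 0 \<le> b \<Longrightarrow> u \<in> borel_measurable borel \<Longrightarrow> (\<And>y. 0 \<le> u y) \<Longrightarrow>
      (\<And>k. (\<integral>\<^sup>+ y. ennreal (indicator (ball 0 (2^k * s)) y * u y) \<partial>lborel)
          \<le> ennreal (b * real (Suc k) * measure lborel (ball (0::'a) (2^k * s)))) \<Longrightarrow>
      (\<integral>\<^sup>+ y. ennreal (wt e s y * u y) \<partial>lborel) \<le> ennreal (C * b)"
    using nn_integral_wt_le[OF assms, where 'a='a] by blast
  show ?thesis
  proof (rule that[of "C * 2 ^ DIM('a)"])
    show "0 \<le> C * 2 ^ DIM('a)" using C by simp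
  next
    fix s :: real assume s: "0 < s"
    have "(\<integral>\<^sup>+ y. ennreal (wt e s (y::'a) * 1) \<partial>lborel) \<le> ennreal (C * 1)"
    proof (rule C(2)[OF s])
      fix k
      have "(\<integral>\<^sup>+ y. ennreal (indicator (ball 0 (2^k * s)) (y::'a) * 1) \<partial>lborel) = emeasure lborel (ball (0::'a) (2^k * s))"
        by (simp add: ennreal_indicator)
      also have "\<dots> = ennreal (measure lborel (ball (0::'a) (2^k * s)))"
        using emeasure_lborel_ball_finite[of "0::'a" "2^k * s"]
        by (intro emeasure_eq_ennreal_measure) auto
      also have "\<dots> \<le> ennreal (1 * real (Suc k) * measure lborel (ball (0::'a) (2^k * s)))"
        by (intro ennreal_leI) (simp add: mult_le_cancel_right1)
      finally show "(\<integral>\<^sup>+ y. ennreal (indicator (ball 0 (2^k * s)) (y::'a) * 1) \<partial>lborel) \<le> \<dots>" .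
    qed auto
    also have "\<dots> \<le> ennreal (C * 2 ^ DIM('a))"
      using C(1) by (intro ennreal_leI mult_left_mono) auto
    finally show "(\<integral>\<^sup>+ y. ennreal (wt e s (y::'a)) \<partial>lborel) \<le> ennreal (C * 2 ^ DIM('a))" by simp
  next
    fix s :: real and f :: "'a \<Rightarrow> real" assume s: "0 < s" and f: "in_BMO f"
    note [measurable] = in_BMO_measurable[OF f]
    let ?N = "BMO_norm f" and ?c = "ball_avg f 0 s"
    have N: "0 \<le> ?N" by (rule BMO_norm_nonneg[OF f])
    have "(\<integral>\<^sup>+ y. ennreal (wt e s y * \<bar>f y - ?c\<bar>) \<partial>lborel) \<le> ennreal (C * (2 ^ DIM('a) * ?N))"
    proof (rule C(2)[OF s])
      fix k
      let ?B = "ball (0::'a) (2^k * s)" and ?ck = "ball_avg f 0 (2^k * s)"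
      have r: "0 < 2^k * s" using s by simp
      have "(\<integral>\<^sup>+ y. ennreal (indicator ?B y * \<bar>f y - ?c\<bar>) \<partial>lborel) = ennreal (\<integral>x\<in>?B. \<bar>f x - ?c\<bar> \<partial>lborel)"
        using BMO_set_integrable[OF f r, of 0 ?c] unfolding set_integrable_def set_lebesgue_integral_def
        by (subst nn_integral_eq_integral) auto
      also have "\<dots> \<le> ennreal (\<integral>x\<in>?B. \<bar>f x - ?ck\<bar> + \<bar>?ck - ?c\<bar> \<partial>lborel)"
        using BMO_set_integrable[OF f r] set_integrable_const_ball
        by (intro ennreal_leI set_integral_mono set_integral_add(1)) auto
      also have "(\<integral>x\<in>?B. \<bar>f x - ?ck\<bar> + \<bar>?ck - ?c\<bar> \<partial>lborel) = (\<integral>x\<in>?B. \<bar>f x - ?ck\<bar> \<partial>lborel) + \<bar>?ck - ?c\<bar> * measure lborel ?B"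
        using BMO_set_integrable[OF f r] set_integrable_const_ball by (subst set_integral_add(2)) (auto simp: set_integral_const_ball)
      also have "ennreal \<dots> \<le> ennreal (?N * measure lborel ?B + real k * (2 ^ DIM('a) * ?N) * measure lborel ?B)"
        using BMO_integral_le[OF f r] ball_avg_dyadic_diff_le[OF f s]
        by (intro ennreal_leI add_mono mult_right_mono) auto
      also have "\<dots> \<le> ennreal (2 ^ DIM('a) * ?N * real (Suc k) * measure lborel ?B)"
      proof (intro ennreal_leI)
        have "?N + real k * (2 ^ DIM('a) * ?N) \<le> 2 ^ DIM('a) * ?N * real (Suc k)"
          using mult_right_mono[OF one_le_power[of "2::real" "DIM('a)"] N] by (simp add: algebra_simps)
        then show "?N * measure lborel ?B + real k * (2 ^ DIM('a) * ?N) * measure lborel ?B \<le> 2 ^ DIM('a) * ?N * real (Suc k) * measure lborel ?B"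
          by (metis distrib_right measure_nonneg mult_right_mono)
      qed
      finally show "(\<integral>\<^sup>+ y. ennreal (indicator ?B y * \<bar>f y - ?c\<bar>) \<partial>lborel) \<le> \<dots>" .
    qed (use N in auto)
    then show "(\<integral>\<^sup>+ y. ennreal (wt e s y * \<bar>f y - ?c\<bar>) \<partial>lborel) \<le> ennreal (C * 2 ^ DIM('a) * ?N)" by (simp add: mult.assoc)
  qed
qed

section \<open>Multilinear forms with cancellation\<close>

lemma product_sigma_finite_lborel: "product_sigma_finite (\<lambda>_::nat. lborel :: 'a::euclidean_space measure)"
  by (simp add: product_sigma_finite_def lborel.sigma_finite_measure_axioms)

lemma prod_coordinate_measurable:
  fixes u :: "nat \<Rightarrow> 'a::euclidean_space \<Rightarrow> real"
  assumes "\<And>i. i < m \<Longrightarrow> u i \<in> borel_measurable borel"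
  shows "(\<lambda>y. \<Prod>i<m. u i (y i)) \<in> borel_measurable (tuple_measure m :: (nat \<Rightarrow> 'a::euclidean_space) measure)"
proof (rule borel_measurable_prod)
  fix i assume "i \<in> {..<m}"
  then have [measurable]: "u i \<in> borel_measurable borel" "(\<lambda>y. y i) \<in> measurable (tuple_measure m) (borel :: 'a measure)"
    using assms measurable_component_singleton[of i "{..<m}" "\<lambda>_. lborel :: 'a measure"] by auto
  show "(\<lambda>y. u i (y i)) \<in> borel_measurable (tuple_measure m :: (nat \<Rightarrow> 'a) measure)" by measurable
qed

text \<open>Tonelli: the product bound on \<open>k\<close> separates the variables. It is asked only
  almost everywhere because the kernels are controlled only off the diagonal.\<close>

lemma multilinear_integrable:
  fixes k :: "(nat \<Rightarrow> 'a::euclidean_space) \<Rightarrow> real"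
  assumes k: "k \<in> borel_measurable (tuple_measure m)"
    and bd: "AE y in tuple_measure m. \<bar>k y\<bar> \<le> M * (\<Prod>j<m. wt e s (y j))" and M: "0 \<le> M"
    and u: "\<And>i. i < m \<Longrightarrow> u i \<in> borel_measurable borel"
    and c: "\<And>i. i < m \<Longrightarrow> 0 \<le> c i"
    and uc: "\<And>i. i < m \<Longrightarrow> (\<integral>\<^sup>+ y. ennreal (wt e s y * \<bar>u i y\<bar>) \<partial>lborel) \<le> ennreal (c i)"
  shows "integrable (tuple_measure m) (\<lambda>y. k y * (\<Prod>i<m. u i (y i)))" (is ?A)
    and "\<bar>\<integral>y. k y * (\<Prod>i<m. u i (y i)) \<partial>tuple_measure m\<bar> \<le> M * (\<Prod>i<m. c i)" (is ?B)
proof -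
  note [measurable] = k prod_coordinate_measurable[OF u]
  have "(\<integral>\<^sup>+y. ennreal (norm (k y * (\<Prod>i<m. u i (y i)))) \<partial>tuple_measure m)
     \<le> (\<integral>\<^sup>+y. ennreal M * (\<Prod>i<m. ennreal (wt e s (y i) * \<bar>u i (y i)\<bar>)) \<partial>tuple_measure m)"
  proof (rule nn_integral_mono_AE, use bd in eventually_elim)
    fix y assume y: "\<bar>k y\<bar> \<le> M * (\<Prod>j<m. wt e s (y j))"
    have "norm (k y * (\<Prod>i<m. u i (y i))) \<le> M * (\<Prod>j<m. wt e s (y j)) * (\<Prod>i<m. \<bar>u i (y i)\<bar>)"
      unfolding real_norm_def abs_mult abs_prod by (intro mult_right_mono y prod_nonneg) auto
    then show "ennreal (norm (k y * (\<Prod>i<m. u i (y i)))) \<le> ennreal M * (\<Prod>i<m. ennreal (wt e s (y i) * \<bar>u i (y i)\<bar>))"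
      using M by (subst prod_ennreal) (auto simp: wt_nonneg prod.distrib ennreal_mult'[symmetric] mult.assoc intro!: ennreal_leI)
  qed
  also have "\<dots> = ennreal M * (\<integral>\<^sup>+y. (\<Prod>i<m. ennreal (wt e s (y i) * \<bar>u i (y i)\<bar>)) \<partial>tuple_measure m)"
  proof (rule nn_integral_cmult)
    have "(\<lambda>y. ennreal (wt e s (y i) * \<bar>u i (y i)\<bar>)) \<in> borel_measurable (tuple_measure m :: (nat \<Rightarrow> 'a) measure)" if "i \<in> {..<m}" for i
    proof -
      have [measurable]: "u i \<in> borel_measurable borel" "(\<lambda>y. y i) \<in> measurable (tuple_measure m) (borel :: 'a measure)"
        using that u measurable_component_singleton[of i "{..<m}" "\<lambda>_. lborel :: 'a measure"] by auto
      show ?thesis by measurable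
    qed
    then show "(\<lambda>y. \<Prod>i<m. ennreal (wt e s (y i) * \<bar>u i (y i)\<bar>)) \<in> borel_measurable (tuple_measure m :: (nat \<Rightarrow> 'a) measure)"
      by (rule borel_measurable_prod_ennreal)
  qed
  also have "(\<integral>\<^sup>+y. (\<Prod>i<m. ennreal (wt e s (y i) * \<bar>u i (y i)\<bar>)) \<partial>tuple_measure m)
      = (\<Prod>i<m. \<integral>\<^sup>+y. ennreal (wt e s y * \<bar>u i y\<bar>) \<partial>lborel)"
  proof (rule product_sigma_finite.product_nn_integral_prod[OF product_sigma_finite_lborel])
    fix i assume "i \<in> {..<m}"
    then have [measurable]: "u i \<in> borel_measurable borel" using u by auto
    show "(\<lambda>y. ennreal (wt e s y * \<bar>u i y\<bar>)) \<in> borel_measurable lborel" by measurable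
  qed simp
  also have "\<dots> \<le> (\<Prod>i<m. ennreal (c i))"
    by (intro prod_mono_ennreal uc) auto
  also have "\<dots> = ennreal (\<Prod>i<m. c i)" using c by (subst prod_ennreal) auto
  finally have le: "(\<integral>\<^sup>+y. ennreal (norm (k y * (\<Prod>i<m. u i (y i)))) \<partial>tuple_measure m) \<le> ennreal (M * (\<Prod>i<m. c i))"
    using M by (auto simp: ennreal_mult' mult_left_mono)
  show A: ?A
    by (rule integrableI_bounded) (use le k prod_coordinate_measurable[OF u] in \<open>auto intro: le_less_trans\<close>)
  have "ennreal (norm (\<integral>y. k y * (\<Prod>i<m. u i (y i)) \<partial>tuple_measure m)) \<le> ennreal (M * (\<Prod>i<m. c i))"
    using integral_norm_bound_ennreal[OF A] le by (rule order_trans)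
  then show ?B
    using M c by (subst (asm) ennreal_le_iff) (auto intro!: mult_nonneg_nonneg prod_nonneg)
qed

text \<open>With the factor \<open>l\<close> missing, the product is constant in the variable
  \<open>l\<close>, so integrating that variable first meets only \<open>k\<close>.\<close>

lemma multilinear_cancel:
  fixes k :: "(nat \<Rightarrow> 'a::euclidean_space) \<Rightarrow> real"
  assumes int: "integrable (tuple_measure m) (\<lambda>y. k y * (\<Prod>i\<in>{..<m} - {l}. u i (y i)))" and l: "l < m"
    and canc: "\<And>y. y \<in> extensional {..<m} \<Longrightarrow> (\<integral>z. k (y(l := z)) \<partial>lborel) = 0"
  shows "(\<integral>y. k y * (\<Prod>i\<in>{..<m} - {l}. u i (y i)) \<partial>tuple_measure m) = 0"
proof -
  have ins: "insert l ({..<m} - {l}) = {..<m}" using l by auto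
  have "(\<integral>y. k y * (\<Prod>i\<in>{..<m} - {l}. u i (y i)) \<partial>tuple_measure m)
      = (\<integral>x. \<integral>z. k (x(l := z)) * (\<Prod>i\<in>{..<m} - {l}. u i ((x(l := z)) i)) \<partial>lborel \<partial>Pi\<^sub>M ({..<m} - {l}) (\<lambda>_. lborel))"
    using product_sigma_finite.product_integral_insert[OF product_sigma_finite_lborel, of "{..<m} - {l}" l
        "\<lambda>y. k y * (\<Prod>i\<in>{..<m} - {l}. u i (y i))"] int unfolding ins by simp
  also have "\<dots> = (\<integral>x. 0 \<partial>Pi\<^sub>M ({..<m} - {l}) (\<lambda>_. lborel :: 'a measure))"
  proof (rule Bochner_Integration.integral_cong[OF refl])
    fix x assume "x \<in> space (Pi\<^sub>M ({..<m} - {l}) (\<lambda>_. lborel :: 'a measure))"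
    then have "x \<in> extensional {..<m}" by (auto simp: space_PiM PiE_def extensional_def)
    moreover have "(\<Prod>i\<in>{..<m} - {l}. u i ((x(l := z)) i)) = (\<Prod>i\<in>{..<m} - {l}. u i (x i))" for z
      by (rule prod.cong) auto
    ultimately show "(\<integral>z. k (x(l := z)) * (\<Prod>i\<in>{..<m} - {l}. u i ((x(l := z)) i)) \<partial>lborel) = 0"
      using canc[of x] by simp
  qed
  finally show ?thesis by simp
qed

text \<open>Factors can be centred one at a time: replacing \<open>f j\<close> by
  \<open>f j - a j\<close> changes the integral by one whose \<open>j\<close>-th factor is a
  constant, and cancellation kills it. Once all are centred, every factor is measured by its BMO
  norm alone.\<close>

lemma multilinear_BMO:
  fixes k :: "(nat \<Rightarrow> 'a::euclidean_space) \<Rightarrow> real"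
  assumes k: "k \<in> borel_measurable (tuple_measure m)"
    and bd: "AE y in tuple_measure m. \<bar>k y\<bar> \<le> M * (\<Prod>j<m. wt e s (y j))" and M: "0 \<le> M" and s: "0 < s"
    and canc: "\<And>y l. y \<in> extensional {..<m} \<Longrightarrow> l < m \<Longrightarrow> (\<integral>z. k (y(l := z)) \<partial>lborel) = 0"
    and C: "0 \<le> C" "(\<integral>\<^sup>+ y. ennreal (wt e s (y::'a)) \<partial>lborel) \<le> ennreal C"
      "\<And>f. in_BMO f \<Longrightarrow>
        (\<integral>\<^sup>+ y. ennreal (wt e s (y::'a) * \<bar>f y - ball_avg f 0 s\<bar>) \<partial>lborel) \<le> ennreal (C * BMO_norm f)"
    and f: "\<And>i. i < m \<Longrightarrow> in_BMO (f i)"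
  shows "integrable (tuple_measure m) (\<lambda>y. k y * (\<Prod>i<m. f i (y i)))" (is ?A)
    and "\<bar>\<integral>y. k y * (\<Prod>i<m. f i (y i)) \<partial>tuple_measure m\<bar> \<le> M * C ^ m * (\<Prod>i<m. BMO_norm (f i))" (is ?B)
proof -
  define a where "a i = ball_avg (f i) 0 s" for i
  \<comment> \<open>A crude bound for all three kinds of factor, \<open>f i\<close>,
    \<open>f i - a i\<close> and the constant 1. It depends on the means \<open>a i\<close> but only
    justifies integrability and does not enter the final estimate.\<close>
  define d where "d i = (C * BMO_norm (f i) + \<bar>a i\<bar> * C) + C" for i
  have N: "0 \<le> BMO_norm (f i)" if "i < m" for i using BMO_norm_nonneg f that by blast
  have fm: "f i \<in> borel_measurable borel" if "i < m" for i using in_BMO_measurable f that by blast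
  have d0: "0 \<le> d i" if "i < m" for i using N[OF that] C(1) by (simp add: d_def)
  have d1: "(\<integral>\<^sup>+ y. ennreal (wt e s y * \<bar>f i y - a i\<bar>) \<partial>lborel) \<le> ennreal (d i)" if "i < m" for i
    unfolding a_def using C(1) N[OF that] by (intro order_trans[OF C(3)[OF f[OF that]]] ennreal_leI) (simp add: d_def)
  have d2: "(\<integral>\<^sup>+ y. ennreal (wt e s (y::'a) * \<bar>1\<bar>) \<partial>lborel) \<le> ennreal (d i)" if "i < m" for i
    using N[OF that] C(1) by (intro order_trans[OF _ order_trans[OF C(2) ennreal_leI]]) (simp_all add: d_def)
  have d3: "(\<integral>\<^sup>+ y. ennreal (wt e s y * \<bar>f i y\<bar>) \<partial>lborel) \<le> ennreal (d i)" if "i < m" for i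
  proof -
    note [measurable] = fm[OF that]
    have "(\<integral>\<^sup>+ y. ennreal (wt e s y * \<bar>f i y\<bar>) \<partial>lborel) \<le>
        (\<integral>\<^sup>+ y. ennreal (wt e s y * \<bar>f i y - a i\<bar>) + ennreal \<bar>a i\<bar> * ennreal (wt e s y) \<partial>lborel)"
    proof (rule nn_integral_mono)
      fix y
      have "wt e s y * \<bar>f i y\<bar> \<le> wt e s y * (\<bar>f i y - a i\<bar> + \<bar>a i\<bar>)"
        by (intro mult_left_mono wt_nonneg) auto
      then show "ennreal (wt e s y * \<bar>f i y\<bar>) \<le> ennreal (wt e s y * \<bar>f i y - a i\<bar>) + ennreal \<bar>a i\<bar> * ennreal (wt e s y)"
        by (subst ennreal_mult'[symmetric]) (auto simp: ennreal_plus[symmetric] wt_nonneg algebra_simps simp del: ennreal_plus intro!: ennreal_leI)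
    qed
    also have "\<dots> = (\<integral>\<^sup>+ y. ennreal (wt e s y * \<bar>f i y - a i\<bar>) \<partial>lborel) + ennreal \<bar>a i\<bar> * (\<integral>\<^sup>+ y. ennreal (wt e s (y::'a)) \<partial>lborel)"
      by (subst nn_integral_add) (auto simp: nn_integral_cmult)
    also have "\<dots> \<le> ennreal (C * BMO_norm (f i)) + ennreal \<bar>a i\<bar> * ennreal C"
      unfolding a_def by (intro add_mono mult_left_mono C f that) auto
    also have "\<dots> = ennreal (C * BMO_norm (f i) + \<bar>a i\<bar> * C)"
      using C(1) N[OF that] by (subst ennreal_mult'[symmetric]) (auto simp: ennreal_plus[symmetric] simp del: ennreal_plus)
    also have "\<dots> \<le> ennreal (d i)" using C(1) by (intro ennreal_leI) (simp add: d_def)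
    finally show ?thesis .
  qed
  \<comment> \<open>Hybrids: factors below \<open>j\<close> centred, the others untouched, so that
    \<open>h 0\<close> is \<open>f\<close> and \<open>h m\<close> is fully centred.\<close>
  define h where "h j i y = (if i < j then f i y - a i else f i y)" for j i :: nat and y
  have hm: "h j i \<in> borel_measurable borel" if "i < m" for i j
    unfolding h_def[abs_def] using fm[OF that] by (cases "i < j") auto
  have hd: "(\<integral>\<^sup>+ y. ennreal (wt e s y * \<bar>h j i y\<bar>) \<partial>lborel) \<le> ennreal (d i)" if "i < m" for i j
    unfolding h_def using d1[OF that] d3[OF that] by (cases "i < j") auto
  have hint: "integrable (tuple_measure m) (\<lambda>y. k y * (\<Prod>i<m. h j i (y i)))" for j
    by (rule multilinear_integrable(1)[OF k bd M, where c=d]) (use hm hd d0 in auto)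
  have step: "(\<integral>y. k y * (\<Prod>i<m. h j i (y i)) \<partial>tuple_measure m) = (\<integral>y. k y * (\<Prod>i<m. h (Suc j) i (y i)) \<partial>tuple_measure m)"
    if j: "j < m" for j
  proof -
    have e1: "(\<Prod>i<m. (if i = j then 1 else h j i (y i))) = (\<Prod>i\<in>{..<m} - {j}. h j i (y i))" for y
      using j by (subst prod.remove[of _ j]) (auto intro!: prod.cong)
    have e2: "(\<Prod>i<m. h j i (y i)) - (\<Prod>i<m. h (Suc j) i (y i)) = a j * (\<Prod>i\<in>{..<m} - {j}. h j i (y i))" for y
    proof -
      have "(\<Prod>i\<in>{..<m} - {j}. h (Suc j) i (y i)) = (\<Prod>i\<in>{..<m} - {j}. h j i (y i))"
        by (intro prod.cong) (auto simp: h_def)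
      then show ?thesis using j
        by (subst (1 2) prod.remove[of _ j]) (auto simp: h_def algebra_simps)
    qed
    have d4: "(\<integral>\<^sup>+ y. ennreal (wt e s y * \<bar>if i = j then 1 else h j i y\<bar>) \<partial>lborel) \<le> ennreal (d i)" if "i < m" for i
      using hd[OF that, of j] d2[OF that] by (cases "i = j") simp_all
    \<comment> \<open>The absent factor enters as the constant 1, so that the integrability lemma
      applies.\<close>
    have "integrable (tuple_measure m) (\<lambda>y. k y * (\<Prod>i<m. (\<lambda>z. if i = j then 1 else h j i z) (y i)))"
      by (rule multilinear_integrable(1)[OF k bd M, where c=d])
        (use hm d0 d4 in auto)
    then have i1: "integrable (tuple_measure m) (\<lambda>y. k y * (\<Prod>i\<in>{..<m} - {j}. h j i (y i)))"
      unfolding e1 .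
    have "(\<integral>y. k y * (\<Prod>i<m. h j i (y i)) \<partial>tuple_measure m) - (\<integral>y. k y * (\<Prod>i<m. h (Suc j) i (y i)) \<partial>tuple_measure m)
        = (\<integral>y. a j * (k y * (\<Prod>i\<in>{..<m} - {j}. h j i (y i))) \<partial>tuple_measure m)"
      by (subst Bochner_Integration.integral_diff[symmetric, OF hint hint])
        (auto simp: right_diff_distrib[symmetric] e2 mult_ac intro!: Bochner_Integration.integral_cong)
    also have "\<dots> = 0"
      using multilinear_cancel[OF i1 j canc] j by simp
    finally show ?thesis by simp
  qed
  have eq: "(\<integral>y. k y * (\<Prod>i<m. h 0 i (y i)) \<partial>tuple_measure m) = (\<integral>y. k y * (\<Prod>i<m. h j i (y i)) \<partial>tuple_measure m)"
    if "j \<le> m" for j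
    using that by (induction j) (auto simp: step)
  show ?A using hint[of 0] by (simp add: h_def)
  have "\<bar>\<integral>y. k y * (\<Prod>i<m. h m i (y i)) \<partial>tuple_measure m\<bar> \<le> M * (\<Prod>i<m. C * BMO_norm (f i))"
    by (rule multilinear_integrable(2)[OF k bd M])
      (use fm C N f in \<open>auto simp: h_def a_def\<close>)
  then show ?B using eq[of m] by (simp add: h_def prod.distrib mult.assoc)
qed

section \<open>Kernel estimates\<close>

lemma abs_le_of_geometric_differences:
  fixes a :: "nat \<Rightarrow> real"
  assumes d: "\<And>k. \<bar>a k - a (Suc k)\<bar> \<le> D * q ^ k" and q: "0 \<le> q" "q < 1" and a: "a \<longlonglongrightarrow> 0"
  shows "\<bar>a 0\<bar> \<le> D / (1 - q)"
proof -
  have s: "(\<lambda>k. D * q ^ k) sums (D * (1 / (1 - q)))"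
    using q by (intro sums_mult geometric_sums) auto
  have D: "0 \<le> D" using d[of 0] by simp
  have "\<bar>a 0 - a n\<bar> \<le> D / (1 - q)" for n
  proof -
    have "\<bar>a 0 - a n\<bar> = \<bar>\<Sum>k<n. a k - a (Suc k)\<bar>" by (simp add: sum_lessThan_telescope')
    also have "\<dots> \<le> (\<Sum>k<n. D * q ^ k)" by (rule order_trans[OF sum_abs sum_mono]) (rule d)
    also have "\<dots> \<le> D * (1 / (1 - q))"
      using s D q by (intro sum_le_suminf[THEN order_trans]) (auto simp: sums_iff)
    finally show ?thesis by simp
  qed
  moreover have "(\<lambda>n. \<bar>a 0 - a n\<bar>) \<longlonglongrightarrow> \<bar>a 0 - 0\<bar>" by (intro tendsto_intros a)
  ultimately show ?thesis by (intro LIMSEQ_le_const2[of "\<lambda>n. \<bar>a 0 - a n\<bar>"]) auto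
qed

text \<open>Split \<open>mn + b = m (n + b/m)\<close> and bound the sum below by
  \<open>norm (y j)\<close> in the \<open>j\<close>-th factor, the exponent being negative. This
  turns a joint power into a product ready for Tonelli.\<close>

lemma prod_wt_ge:
  fixes y :: "nat \<Rightarrow> 'a::euclidean_space"
  assumes m: "0 < m" and S: "0 < S" and b: "0 < b"
  shows "S powr b * (S + (\<Sum>j<m. norm (y j))) powr (- (real m * DIM('a) + b)) \<le> (\<Prod>j<m. wt (b / m) S (y j))"
proof -
  let ?U = "S + (\<Sum>j<m. norm (y j))" and ?n = "real DIM('a)"
  have U: "0 < ?U" using S by (intro add_pos_nonneg sum_nonneg) auto
  have "S powr b = (S powr (b / m)) ^ m" using m S by (simp add: powr_realpow[symmetric] powr_powr)
  moreover have "?U powr (- (real m * ?n + b)) = (?U powr (- (?n + b / m))) ^ m"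
  proof -
    have "- (real m * ?n + b) = - (?n + b / m) * real m" using m by (simp add: field_simps)
    then show ?thesis using U by (simp add: powr_realpow[symmetric] powr_powr)
  qed
  ultimately have "S powr b * ?U powr (- (real m * ?n + b)) = (\<Prod>j<m. S powr (b / m) * ?U powr (- (?n + b / m)))"
    by (simp add: power_mult_distrib)
  also have "\<dots> \<le> (\<Prod>j<m. wt (b / m) S (y j))"
  proof (intro prod_mono conjI)
    fix j assume "j \<in> {..<m}"
    then have "norm (y j) \<le> (\<Sum>j<m. norm (y j))" by (intro member_le_sum) auto
    then show "S powr (b / m) * ?U powr (- (?n + b / m)) \<le> wt (b / m) S (y j)"
      unfolding wt_def using S b m divide_nonneg_nonneg[of b "real m"]
      by (intro mult_left_mono powr_mono2') (auto intro: add_pos_nonneg simp del: divide_nonneg_nonneg)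
  qed auto
  finally show ?thesis .
qed

lemma wt_scale:
  fixes y :: "'a::euclidean_space"
  assumes "0 < t" "0 < S"
  shows "wt e S (y /\<^sub>R t) = t ^ DIM('a) * wt e (t * S) y"
proof -
  have "S + norm (y /\<^sub>R t) = (t * S + norm y) / t" using assms by (simp add: field_simps)
  moreover have "((t * S + norm y) / t) powr (- (real DIM('a) + e)) = (t * S + norm y) powr (- (real DIM('a) + e)) * t powr (real DIM('a) + e)"
    by (simp only: powr_divide powr_minus inverse_eq_divide) simp
  moreover have "t powr (real DIM('a) + e) = t ^ DIM('a) * t powr e" using assms by (simp add: powr_add powr_realpow)
  ultimately show ?thesis using assms by (simp add: wt_def powr_mult mult_ac)
qed

text \<open>Decay in \<open>x\<close> is recovered by pushing one variable
  \<open>y\<^sub>0\<close> to infinity along the ray from \<open>x\<close> in steps admissible for the \<open>y\<close>-smoothness.\<close>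

lemma kernel_decay_in_x:
  fixes K :: "'a::euclidean_space \<Rightarrow> (nat \<Rightarrow> 'a) \<Rightarrow> real"
  assumes m: "0 < m" and N: "0 < N" and g: "0 < g" and C: "0 < C"
    and size: "\<And>x y. y \<in> extensional {..<m} \<Longrightarrow> off_diag m x y \<Longrightarrow>
          \<bar>K x y\<bar> \<le> C * (1 + (\<Sum>j<m. norm (y j))) powr (- N)"
    and smooth: "\<And>x y i y'. y \<in> extensional {..<m} \<Longrightarrow> i < m \<Longrightarrow>
          2 * norm (y i - y') \<le> norm (x - y i) \<Longrightarrow>
          \<bar>K x y - K x (y(i := y'))\<bar> \<le>
            C * norm (y i - y') powr g * (1 + (\<Sum>j<m. norm (x - y j))) powr (- (N + g))"
    and y: "y \<in> extensional {..<m}" and xy: "x \<noteq> y 0"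
  shows "\<bar>K x y\<bar> \<le> C * norm (x - y 0) powr (- N) / (1 - (3/2) powr (- N))"
proof -
  define v where "v = y 0 - x"
  define r where "r k = (3/2) ^ k * norm v" for k :: nat
  \<comment> \<open>The ratio 3/2 is the largest that the \<open>y\<close>-smoothness allows: each
    move has length half the current distance to \<open>x\<close>.\<close>
  define Y where "Y k = y(0 := x + (3/2) ^ k *\<^sub>R v)" for k :: nat
  have v: "0 < norm v" using xy by (simp add: v_def)
  have r: "0 < r k" for k using v by (simp add: r_def)
  have Yext: "Y k \<in> extensional {..<m}" for k using y m by (auto simp: Y_def extensional_def)
  have Y0: "Y k 0 = x + (3/2) ^ k *\<^sub>R v" for k by (simp add: Y_def)
  have nY: "norm (x - Y k 0) = r k" for k by (simp add: Y0 r_def)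
  have diff: "\<bar>K x (Y k) - K x (Y (Suc k))\<bar> \<le> (C * norm v powr (- N)) * ((3/2) powr (- N)) ^ k" for k
  proof -
    have "Y k 0 - (x + (3/2) ^ Suc k *\<^sub>R v) = ((3/2) ^ k - (3/2) ^ Suc k) *\<^sub>R v"
      by (simp add: Y0 scaleR_left_diff_distrib del: power_Suc)
    then have nd: "norm (Y k 0 - (x + (3/2) ^ Suc k *\<^sub>R v)) = r k / 2"
      by (simp add: r_def abs_if)
    have "\<bar>K x (Y k) - K x ((Y k)(0 := x + (3/2) ^ Suc k *\<^sub>R v))\<bar> \<le>
            C * (r k / 2) powr g * (1 + (\<Sum>j<m. norm (x - Y k j))) powr (- (N + g))"
      using smooth[OF Yext m, of k "x + (3/2) ^ Suc k *\<^sub>R v" x] unfolding nd nY by simp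
    also have "(Y k)(0 := x + (3/2) ^ Suc k *\<^sub>R v) = Y (Suc k)" by (simp add: Y_def)
    \<comment> \<open>Keeping only the term \<open>j = 0\<close> of the sum, the powers of exponent
      \<open>g\<close> cancel and leave \<open>r k powr (- N)\<close>, which is geometric in
      \<open>k\<close>.\<close>
    also have "C * (r k / 2) powr g * (1 + (\<Sum>j<m. norm (x - Y k j))) powr (- (N + g)) \<le>
        C * r k powr g * r k powr (- (N + g))"
    proof (rule mult_mono[OF mult_left_mono[OF powr_mono2] powr_mono2'])
      have "norm (x - Y k 0) \<le> (\<Sum>j<m. norm (x - Y k j))" using m by (intro member_le_sum) auto
      then show "r k \<le> 1 + (\<Sum>j<m. norm (x - Y k j))" unfolding nY by simp
    qed (use C r[of k] g N in auto)
    also have "\<dots> = C * r k powr (- N)"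
    proof -
      have "r k powr g * r k powr (- (N + g)) = r k powr (- N)" by (simp add: powr_add[symmetric])
      then show ?thesis by (simp only: mult.assoc)
    qed
    also have "r k powr (- N) = ((3/2) powr (- N)) ^ k * norm v powr (- N)"
      unfolding r_def powr_mult by (simp add: powr_realpow[symmetric] powr_powr mult.commute)
    finally show ?thesis by (simp only: mult_ac)
  qed
  have pow_at_top: "filterlim (\<lambda>k. (3/2::real) ^ k) at_top sequentially" by real_asymp
  \<comment> \<open>Far out on the ray the size condition, which decays in \<open>y\<close>, sends
    the kernel to 0.\<close>
  have lim: "(\<lambda>k. K x (Y k)) \<longlonglongrightarrow> 0"
  proof (rule tendsto_rabs_zero_cancel, rule tendsto_sandwich[OF _ _ tendsto_const])
    have "filterlim (\<lambda>k. - norm x + norm v * (3/2) ^ k) at_top sequentially"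
      using v by (intro filterlim_tendsto_add_at_top[OF tendsto_const]
        filterlim_tendsto_pos_mult_at_top[OF tendsto_const] pow_at_top) auto
    then have "filterlim (\<lambda>k. 1 + (\<Sum>j<m. norm (Y k j))) at_top sequentially"
    proof (rule filterlim_at_top_mono, intro always_eventually allI)
      fix k
      have "r k = norm (Y k 0 - x)" by (simp add: nY norm_minus_commute)
      also have "\<dots> \<le> norm (Y k 0) + norm x" by (rule norm_triangle_ineq4)
      also have "norm (Y k 0) \<le> (\<Sum>j<m. norm (Y k j))" using m by (intro member_le_sum) auto
      finally show "- norm x + norm v * (3/2) ^ k \<le> 1 + (\<Sum>j<m. norm (Y k j))" by (simp add: r_def mult.commute)
    qed
    then have "(\<lambda>k. (1 + (\<Sum>j<m. norm (Y k j))) powr (- N)) \<longlonglongrightarrow> 0"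
      using N by (intro tendsto_neg_powr) auto
    from tendsto_mult_right_zero[OF this, of C]
    show "(\<lambda>k. C * (1 + (\<Sum>j<m. norm (Y k j))) powr (- N)) \<longlonglongrightarrow> 0" .
    have "off_diag m x (Y k)" for k
      using m v by (auto simp: off_diag_def Y0 intro!: exI[of _ 0])
    then show "\<forall>\<^sub>F k in sequentially. \<bar>K x (Y k)\<bar> \<le> C * (1 + (\<Sum>j<m. norm (Y k j))) powr (- N)"
      using size Yext by (intro always_eventually allI) auto
  qed auto
  have "(3/2::real) powr (- N) < 1" using N by (intro powr_less_one) auto
  from abs_le_of_geometric_differences[OF diff _ this lim]
  have "\<bar>K x (Y 0)\<bar> \<le> C * norm v powr (- N) / (1 - (3/2) powr (- N))" by simp
  moreover have "Y 0 = y" by (auto simp: Y_def v_def)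
  ultimately show ?thesis by (simp add: v_def norm_minus_commute)
qed

text \<open>The weights have scale \<open>1 + norm x\<close> for the size and scale
  \<open>norm x\<close> for the difference with the origin. In each bound one power of the scale
  normalises the weights, and a further factor, \<open>(1 / (1 + norm x)) powr d\<close> or
  \<open>norm x powr b\<close>, is left over as gain.\<close>

lemma LP_kernel_bounds:
  fixes K :: "'a::euclidean_space \<Rightarrow> (nat \<Rightarrow> 'a) \<Rightarrow> real"
  assumes K: "LP_kernel m K" and m: "0 < m"
  obtains A d b where "0 < A" "0 < d" "0 < b"
    "\<And>x y. y \<in> extensional {..<m} \<Longrightarrow> off_diag m x y \<Longrightarrow>
       \<bar>K x y\<bar> \<le> A * (1 / (1 + norm x)) powr d * (\<Prod>j<m. wt (d / m) (1 + norm x) (y j))"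
    "\<And>x y. y \<in> extensional {..<m} \<Longrightarrow> off_diag m x y \<Longrightarrow> off_diag m 0 y \<Longrightarrow> 0 < norm x \<Longrightarrow> norm x \<le> 1 \<Longrightarrow>
       \<bar>K x y - K 0 y\<bar> \<le> A * norm x powr b * (\<Prod>j<m. wt (b / m) (norm x) (y j))"
proof -
  obtain d g C where d: "0 < d" and g: "0 < g" and C: "0 < C"
    and size': "\<forall>x y. y \<in> extensional {..<m} \<longrightarrow> off_diag m x y \<longrightarrow>
          \<bar>K x y\<bar> \<le> C * (1 + (\<Sum>j<m. norm (y j))) powr (- (real m * DIM('a) + d))"
    and smy': "\<forall>x y i y'. y \<in> extensional {..<m} \<longrightarrow> i < m \<longrightarrow>
          2 * norm (y i - y') \<le> norm (x - y i) \<longrightarrow>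
          \<bar>K x y - K x (y(i := y'))\<bar> \<le>
            C * norm (y i - y') powr g *
            (1 + (\<Sum>j<m. norm (x - y j))) powr (- (real m * DIM('a) + d + g))"
    and smx': "\<forall>x x' y. y \<in> extensional {..<m} \<longrightarrow>
          2 * norm (x - x') \<le> Max ((\<lambda>j. norm (x - y j)) ` {..<m}) \<longrightarrow>
          \<bar>K x y - K x' y\<bar> \<le>
            C * norm (x - x') powr g *
            (1 + (\<Sum>j<m. norm (x - y j))) powr (- (real m * DIM('a) + d + g))"
    using K unfolding LP_kernel_def by (elim conjE exE) (rule that)
  note size = size'[rule_format] and smy = smy'[rule_format] and smx = smx'[rule_format]
  define M where "M = real m * DIM('a)"
  have M1: "1 \<le> M" unfolding M_def using m mult_mono[of 1 "real m" 1 "real DIM('a)"] by (simp add: Suc_leI)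
  define q where "q = (3/2::real) powr (- (M + d))"
  have q: "0 < q" "q < 1" unfolding q_def using d M1 by (auto intro!: powr_less_one)
  \<comment> \<open>\<open>b <= g / 2\<close> lets \<open>norm x powr g\<close> yield two factors
    \<open>norm x powr b\<close>, one as gain and one to normalise the weights;
    \<open>b <= d\<close> keeps decay of order \<open>M + b\<close>; \<open>b <= 1 <= M\<close> is
    used when all \<open>y j\<close> are near \<open>x\<close>.\<close>
  define b where "b = Min {d, g / 2, 1}"
  have b: "0 < b" "b \<le> d" "b + b \<le> g" "b \<le> 1" using d g by (auto simp: b_def)
  define A1 where "A1 = C * 3 powr (M + d) / (1 - q)"
  define A2 where "A2 = 2 * C * (3 * real m + 1) powr (M + b)"
  have CA1: "C * 3 powr (M + d) \<le> A1" unfolding A1_def using q C by (simp add: field_simps)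
  have A10: "0 < A1" unfolding A1_def using q C by simp
  have A20: "0 < A2" unfolding A2_def using C by simp
  have sizex: "\<bar>K x y\<bar> \<le> A1 * (1 + norm x + (\<Sum>j<m. norm (y j))) powr (- (M + d))"
    if y: "y \<in> extensional {..<m}" "off_diag m x y" for x y
  proof -
    let ?A = "1 + (\<Sum>j<m. norm (y j))" and ?T = "1 + norm x + (\<Sum>j<m. norm (y j))"
    have y0: "norm (y 0) \<le> (\<Sum>j<m. norm (y j))" using m by (intro member_le_sum) auto
    have key: "u powr (- (M + d)) \<le> 3 powr (M + d) * ?T powr (- (M + d))" if "0 < u" "?T \<le> 3 * u" for u
    proof -
      have "(3 * u) powr (- (M + d)) \<le> ?T powr (- (M + d))"
        using that y0 M1 d by (intro powr_mono2') (auto intro!: add_pos_nonneg sum_nonneg)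
      then have "3 powr (M + d) * (3 * u) powr (- (M + d)) \<le> 3 powr (M + d) * ?T powr (- (M + d))"
        by (intro mult_left_mono) auto
      moreover have "3 powr (M + d) * (3 * u) powr (- (M + d)) = u powr (- (M + d))"
      proof -
        have "(3::real) powr (M + d) * 3 powr (- (M + d)) = 1" unfolding powr_add[symmetric] by simp
        then show ?thesis unfolding powr_mult by (simp only: mult.assoc[symmetric] mult_1_left)
      qed
      ultimately show ?thesis by (simp only:)
    qed
    \<comment> \<open>If \<open>norm x <= 2 * ?A\<close> then \<open>?T <= 3 * ?A\<close> and the
      size condition is enough. Otherwise \<open>norm x\<close> so dominates
      \<open>norm (y 0)\<close> that \<open>?T <= 3 * norm (x - y 0)\<close>, and the decay
      recovered in \<open>norm (x - y 0)\<close> takes over.\<close>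
    show ?thesis
    proof (cases "norm x \<le> 2 * ?A")
      case True
      have "\<bar>K x y\<bar> \<le> C * ?A powr (- (M + d))" using size[OF y] by (simp add: M_def)
      also have "\<dots> \<le> C * (3 powr (M + d) * ?T powr (- (M + d)))"
        using C True by (intro mult_left_mono key) (auto intro!: add_pos_nonneg sum_nonneg)
      also have "\<dots> \<le> A1 * ?T powr (- (M + d))"
        using mult_right_mono[OF CA1, of "?T powr (- (M + d))"] by (simp add: mult.assoc)
      finally show ?thesis .
    next
      case False
      have n0: "norm x \<le> norm (x - y 0) + norm (y 0)" using norm_triangle_ineq[of "x - y 0" "y 0"] by simp
      have "1 \<le> u \<and> 1 + X + T \<le> 3 * u" if "X \<le> u + w" "\<not> X \<le> 2 * (1 + T)" "w \<le> T" "0 \<le> w" for X u w T :: real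
        using that by (auto simp: algebra_simps)
      from this[OF n0 False y0 norm_ge_zero]
      have pos: "0 < norm (x - y 0)" and T: "?T \<le> 3 * norm (x - y 0)" by (auto simp del: zero_less_norm_iff)
      have "\<bar>K x y\<bar> \<le> C * norm (x - y 0) powr (- (M + d)) / (1 - q)"
        unfolding q_def
        by (rule kernel_decay_in_x[OF m _ g C size[folded M_def] smy[folded M_def] y(1)])
          (use M1 d pos in auto)
      also have "\<dots> \<le> C * (3 powr (M + d) * ?T powr (- (M + d))) / (1 - q)"
        using C q by (intro divide_right_mono mult_left_mono key pos T) auto
      also have "\<dots> = A1 * ?T powr (- (M + d))" by (simp add: A1_def)
      finally show ?thesis .
    qed
  qed
  show ?thesis
  proof (rule that[of "A1 + A2 + 2 * A1 * (3 * real m + 1) powr (M + b)" d b])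
    show "0 < A1 + A2 + 2 * A1 * (3 * real m + 1) powr (M + b)" using A10 A20 by (intro add_pos_nonneg) auto
    show "0 < d" "0 < b" by fact+
  next
    fix x :: 'a and y :: "nat \<Rightarrow> 'a"
    assume y: "y \<in> extensional {..<m}" "off_diag m x y"
    let ?S = "1 + norm x"
    have S: "0 < ?S" by (intro add_pos_nonneg) auto
    have "(1 / ?S) powr d * ?S powr d = 1" using S by (simp add: powr_mult[symmetric])
    then have "A1 * (?S + (\<Sum>j<m. norm (y j))) powr (- (M + d))
       = A1 * (1 / ?S) powr d * (?S powr d * (?S + (\<Sum>j<m. norm (y j))) powr (- (M + d)))"
      by (simp only: mult.assoc[symmetric]) (simp only: mult.assoc mult_1_right)
    also have "\<dots> \<le> A1 * (1 / ?S) powr d * (\<Prod>j<m. wt (d / m) ?S (y j))"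
      using A10 prod_wt_ge[OF m S d, of y] by (intro mult_left_mono) (auto simp: M_def)
    also have "\<dots> \<le> (A1 + A2 + 2 * A1 * (3 * real m + 1) powr (M + b)) * (1 / ?S) powr d * (\<Prod>j<m. wt (d / m) ?S (y j))"
      using A10 A20 by (intro mult_right_mono prod_nonneg) (auto simp: wt_nonneg)
    finally show "\<bar>K x y\<bar> \<le> (A1 + A2 + 2 * A1 * (3 * real m + 1) powr (M + b)) * (1 / ?S) powr d * (\<Prod>j<m. wt (d / m) ?S (y j))"
      using sizex[OF y] by simp
  next
    fix x :: 'a and y :: "nat \<Rightarrow> 'a"
    assume y: "y \<in> extensional {..<m}" "off_diag m x y" "off_diag m 0 y" and x: "0 < norm x" "norm x \<le> 1"
    \<comment> \<open>Origin of \<open>?W\<close>: if every \<open>y j\<close> lies within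
      \<open>2 * norm x\<close> of \<open>x\<close>, the norms of the \<open>y j\<close> sum to at
      most \<open>3 m\<close> times \<open>norm x\<close>, so
      \<open>?U <= ?W * norm x\<close>.\<close>
    let ?U = "norm x + (\<Sum>j<m. norm (y j))" and ?W = "3 * real m + 1"
    have U: "0 < ?U" using x by (intro add_pos_nonneg sum_nonneg) auto
    have tri: "(\<Sum>j<m. norm (y j)) \<le> real m * norm x + (\<Sum>j<m. norm (x - y j))"
    proof -
      have "(\<Sum>j<m. norm (y j)) \<le> (\<Sum>j<m. norm x + norm (x - y j))"
      proof (rule sum_mono)
        fix j show "norm (y j) \<le> norm x + norm (x - y j)" using norm_triangle_ineq4[of x "x - y j"] by simp
      qed
      then show ?thesis by (simp add: sum.distrib)
    qed
    have Uk: "(?W * u) powr (- (M + b)) \<le> ?U powr (- (M + b))" if "0 < u" "?U \<le> ?W * u" for u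
      using that U M1 b by (intro powr_mono2') auto
    have W1: "?W powr (M + b) * ?W powr (- (M + b)) = 1" unfolding powr_add[symmetric] by simp
    have Uk': "u powr (- (M + b)) \<le> ?W powr (M + b) * ?U powr (- (M + b))" if "0 < u" "?U \<le> ?W * u" for u
    proof -
      have "u powr (- (M + b)) = ?W powr (M + b) * (?W * u) powr (- (M + b))"
        unfolding powr_mult mult.assoc[symmetric] W1 by simp
      then show ?thesis using Uk[OF that] by (simp add: mult_left_mono)
    qed
    have main: "\<bar>K x y - K 0 y\<bar> \<le> (A2 + 2 * A1 * ?W powr (M + b)) * (norm x powr (b + b) * ?U powr (- (M + b)))"
    proof (cases "2 * norm (x - 0) \<le> Max ((\<lambda>j. norm (x - y j)) ` {..<m})")
      case True
      let ?S = "1 + (\<Sum>j<m. norm (x - y j))"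
      have S: "1 \<le> ?S" by (simp add: sum_nonneg)
      have "\<bar>K x y - K 0 y\<bar> \<le> C * norm x powr g * ?S powr (- (M + d + g))"
        using smx[OF y(1) True] by (simp add: M_def)
      also have "\<dots> \<le> C * norm x powr (b + b) * ?S powr (- (M + b))"
        using C x b S d g by (intro mult_mono[OF mult_left_mono[OF powr_mono'] powr_mono]) auto
      also have "\<dots> \<le> C * norm x powr (b + b) * (?W powr (M + b) * ?U powr (- (M + b)))"
      proof (intro mult_left_mono Uk')
        have "real m * norm x \<le> real m" using x by (simp add: mult_left_le)
        moreover have "(\<Sum>j<m. norm (x - y j)) \<le> ?W * (\<Sum>j<m. norm (x - y j))"
          using mult_right_mono[of 1 ?W "\<Sum>j<m. norm (x - y j)"] by (simp add: sum_nonneg)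
        ultimately show "?U \<le> ?W * ?S" using tri x by (simp add: distrib_left)
      qed (use S C in auto)
      also have "\<dots> = (C * ?W powr (M + b)) * (norm x powr (b + b) * ?U powr (- (M + b)))" by (simp only: mult_ac)
      also have "\<dots> \<le> (A2 + 2 * A1 * ?W powr (M + b)) * (norm x powr (b + b) * ?U powr (- (M + b)))"
        using C A10 by (intro mult_right_mono) (auto simp: A2_def intro!: add_increasing2)
      finally show ?thesis .
    next
      case False
      have less: "norm (x - y j) < 2 * norm x" if "j < m" for j
      proof -
        have "norm (x - y j) \<le> Max ((\<lambda>j. norm (x - y j)) ` {..<m})" using that by (intro Max_ge) auto
        then show ?thesis using False by simp
      qed
      have "(\<Sum>j<m. norm (x - y j)) \<le> (\<Sum>j<m. 2 * norm x)" by (intro sum_mono less_imp_le less) auto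
      then have "?U \<le> ?W * norm x" using tri by (simp add: algebra_simps)
      from Uk'[OF x(1) this]
      have "norm x powr (b + b) * norm x powr (- (M + b)) \<le> norm x powr (b + b) * (?W powr (M + b) * ?U powr (- (M + b)))"
        by (intro mult_left_mono) auto
      moreover have "1 \<le> norm x powr (b + b) * norm x powr (- (M + b))"
        unfolding powr_add[symmetric] using powr_mono'[of "b + b + - (M + b)" 0 "norm x"] x b M1 by auto
      ultimately have one: "1 \<le> norm x powr (b + b) * (?W powr (M + b) * ?U powr (- (M + b)))" by linarith
      have le1: "\<bar>K x' y\<bar> \<le> A1" if "off_diag m x' y" for x'
      proof -
        have "(1 + norm x' + (\<Sum>j<m. norm (y j))) powr (- (M + d)) \<le> 1"
          using M1 d powr_mono2'[of "- (M + d)" 1 "1 + norm x' + (\<Sum>j<m. norm (y j))"] by (simp add: sum_nonneg)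
        then have "A1 * (1 + norm x' + (\<Sum>j<m. norm (y j))) powr (- (M + d)) \<le> A1"
          using A10 by (simp add: mult_left_le)
        then show ?thesis by (rule order_trans[OF sizex[OF y(1) that]])
      qed
      have "\<bar>K x y - K 0 y\<bar> \<le> 2 * A1 * 1" using le1[OF y(2)] le1[OF y(3)] by simp
      also have "\<dots> \<le> 2 * A1 * (norm x powr (b + b) * (?W powr (M + b) * ?U powr (- (M + b))))"
        using one A10 by (intro mult_left_mono) auto
      also have "\<dots> = (2 * A1 * ?W powr (M + b)) * (norm x powr (b + b) * ?U powr (- (M + b)))" by (simp only: mult_ac)
      also have "\<dots> \<le> (A2 + 2 * A1 * ?W powr (M + b)) * (norm x powr (b + b) * ?U powr (- (M + b)))"
        using A20 by (intro mult_right_mono) auto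
      finally show ?thesis .
    qed
    also have "\<dots> \<le> (A1 + A2 + 2 * A1 * ?W powr (M + b)) * (norm x powr b * (\<Prod>j<m. wt (b / m) (norm x) (y j)))"
    proof (rule mult_mono)
      show "norm x powr (b + b) * ?U powr (- (M + b)) \<le> norm x powr b * (\<Prod>j<m. wt (b / m) (norm x) (y j))"
        using prod_wt_ge[OF m x(1) b(1), of y] unfolding powr_add mult.assoc M_def by (intro mult_left_mono) auto
    qed (use A10 A20 in \<open>auto intro!: add_nonneg_nonneg\<close>)
    finally show "\<bar>K x y - K 0 y\<bar> \<le> (A1 + A2 + 2 * A1 * ?W powr (M + b)) * norm x powr b * (\<Prod>j<m. wt (b / m) (norm x) (y j))"
      by (simp only: mult.assoc)
  qed
qed

section \<open>Bounds for the dilated operators\<close>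

lemma lborel_integral_scale:
  fixes f :: "'a::euclidean_space \<Rightarrow> real"
  assumes f: "integrable lborel f" and t: "0 < t"
  shows "integrable lborel (\<lambda>z. f (z /\<^sub>R t))"
    and "(\<integral>z. f (z /\<^sub>R t) \<partial>lborel) = t ^ DIM('a) * (\<integral>z. f z \<partial>lborel)"
proof -
  have fm [measurable]: "f \<in> borel_measurable borel" using borel_measurable_integrable[OF f] by simp
  have eq: "(lborel :: 'a measure) = density (distr lborel borel (\<lambda>x. 0 + t *\<^sub>R x)) (\<lambda>_. ennreal (t ^ DIM('a)))"
    using lborel_affine[of t "0::'a"] t by simp
  have m: "(\<lambda>x. t *\<^sub>R x) \<in> measurable lborel (borel :: 'a measure)" by measurable
  have fm2: "(\<lambda>z. f (z /\<^sub>R t)) \<in> borel_measurable borel" by measurable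
  show "integrable lborel (\<lambda>z. f (z /\<^sub>R t))"
    using f t m fm2 by (subst eq) (simp add: integrable_density integrable_distr_eq)
  show "(\<integral>z. f (z /\<^sub>R t) \<partial>lborel) = t ^ DIM('a) * (\<integral>z. f z \<partial>lborel)"
    using t m fm2 by (subst eq) (simp add: integral_density integral_distr)
qed

text \<open>The exceptional set is the single tuple with all entries \<open>x\<close>, a box with
  null sides.\<close>

lemma AE_off_diag:
  assumes "0 < m"
  shows "AE y in tuple_measure m. off_diag m (x::'a::euclidean_space) y"
proof -
  have "emeasure (tuple_measure m) (PiE {..<m} (\<lambda>_. {x})) = (\<Prod>i<m. emeasure lborel {x})"
    by (rule product_sigma_finite.emeasure_PiM[OF product_sigma_finite_lborel]) auto
  also have "\<dots> = 0" using assms by (intro prod_zero) auto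
  finally have "PiE {..<m} (\<lambda>_. {x}) \<in> null_sets (tuple_measure m)"
    by (rule null_setsI) (rule sets_PiM_I_finite, auto)
  then show ?thesis
  proof (rule AE_I')
    show "{y \<in> space (tuple_measure m). \<not> off_diag m x y} \<subseteq> PiE {..<m} (\<lambda>_. {x})"
      by (auto simp: off_diag_def space_PiM PiE_iff extensional_def intro!: ext)
  qed
qed

text \<open>Measurability is needed jointly in \<open>t\<close>, \<open>x\<close> and
  \<open>y\<close>: \<open>LP_G\<close> integrates out \<open>y\<close>, and the square function
  then integrates in \<open>t\<close> and must be measurable in \<open>x\<close>.\<close>

lemma dil_kernel_measurable:
  fixes K :: "'a::euclidean_space \<Rightarrow> (nat \<Rightarrow> 'a) \<Rightarrow> real"
  assumes "LP_kernel m K"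
  shows "(\<lambda>((t, x), y). dil_kernel m K t x y) \<in> borel_measurable ((borel \<Otimes>\<^sub>M borel) \<Otimes>\<^sub>M tuple_measure m)"
proof -
  let ?N = "((borel :: real measure) \<Otimes>\<^sub>M (borel :: 'a measure)) \<Otimes>\<^sub>M (tuple_measure m :: (nat \<Rightarrow> 'a) measure)"
  have K: "(\<lambda>(x, y). K x y) \<in> borel_measurable (lborel \<Otimes>\<^sub>M tuple_measure m)"
    using assms by (simp add: LP_kernel_def)
  have [measurable]: "(\<lambda>p. fst (fst p)) \<in> measurable ?N borel" "(\<lambda>p. snd (fst p)) \<in> measurable ?N borel"
    by measurable
  have y: "(\<lambda>p. snd p i) \<in> measurable ?N borel" if "i < m" for i
    using that by (intro measurable_compose[OF measurable_snd, of "\<lambda>y. y i"])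
      (use measurable_component_singleton[of i "{..<m}" "\<lambda>_. lborel :: 'a measure"] in auto)
  have r: "(\<lambda>p. restrict (\<lambda>i. snd p i /\<^sub>R fst (fst p)) {..<m}) \<in> measurable ?N (tuple_measure m)"
  proof (rule measurable_restrict)
    fix i assume "i \<in> {..<m}"
    then have [measurable]: "(\<lambda>p. snd p i) \<in> measurable ?N borel" using y by auto
    show "(\<lambda>p. snd p i /\<^sub>R fst (fst p)) \<in> measurable ?N lborel"
      unfolding measurable_lborel1 by measurable
  qed
  have x: "(\<lambda>p. snd (fst p) /\<^sub>R fst (fst p)) \<in> measurable ?N (lborel :: 'a measure)"
    unfolding measurable_lborel1 by measurable
  have "(\<lambda>p. case (snd (fst p) /\<^sub>R fst (fst p), restrict (\<lambda>i. snd p i /\<^sub>R fst (fst p)) {..<m}) of (x, y) \<Rightarrow> K x y) \<in> borel_measurable ?N"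
    by (rule measurable_compose[OF measurable_Pair[OF x r] K])
  then have [measurable]: "(\<lambda>p. K (snd (fst p) /\<^sub>R fst (fst p)) (restrict (\<lambda>i. snd p i /\<^sub>R fst (fst p)) {..<m})) \<in> borel_measurable ?N"
    by simp
  have "(\<lambda>p. dil_kernel m K (fst (fst p)) (snd (fst p)) (snd p)) \<in> borel_measurable ?N"
    unfolding dil_kernel_def by measurable
  then show ?thesis by (simp add: case_prod_beta')
qed

lemma LP_G_measurable:
  fixes K :: "'a::euclidean_space \<Rightarrow> (nat \<Rightarrow> 'a) \<Rightarrow> real"
  assumes K: "LP_kernel m K" and f: "\<And>i. i < m \<Longrightarrow> f i \<in> borel_measurable borel"
  shows "(\<lambda>(t, x). LP_G m K t f x) \<in> borel_measurable (borel \<Otimes>\<^sub>M borel)"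
proof -
  interpret T: sigma_finite_measure "tuple_measure m :: (nat \<Rightarrow> 'a) measure"
    by (rule product_sigma_finite.sigma_finite[OF product_sigma_finite_lborel]) simp
  have p: "(\<lambda>p. \<Prod>i<m. f i (snd p i)) \<in> borel_measurable ((borel \<Otimes>\<^sub>M (borel :: 'a measure)) \<Otimes>\<^sub>M tuple_measure m)"
    by (rule measurable_compose[OF measurable_snd prod_coordinate_measurable[OF f]])
  have "(\<lambda>(q, y). dil_kernel m K (fst q) (snd q) y * (\<Prod>i<m. f i (y i)))
      \<in> borel_measurable ((borel \<Otimes>\<^sub>M borel) \<Otimes>\<^sub>M tuple_measure m)"
    using borel_measurable_times[OF dil_kernel_measurable[OF K] p] by (simp add: case_prod_beta')
  from T.borel_measurable_lebesgue_integral[OF this] show ?thesis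
    by (simp add: LP_G_def case_prod_beta')
qed

lemma dil_kernel_section_measurable:
  fixes K :: "'a::euclidean_space \<Rightarrow> (nat \<Rightarrow> 'a) \<Rightarrow> real"
  assumes "LP_kernel m K"
  shows "dil_kernel m K t x \<in> borel_measurable (tuple_measure m)"
  using measurable_compose[OF measurable_Pair1'[of "(t, x)" "borel \<Otimes>\<^sub>M borel" "tuple_measure m"] dil_kernel_measurable[OF assms]]
  by (simp add: space_pair_measure)

lemma dil_kernel_cancel:
  fixes K :: "'a::euclidean_space \<Rightarrow> (nat \<Rightarrow> 'a) \<Rightarrow> real"
  assumes K: "LP_kernel m K" and t: "0 < t" and l: "l < m"
  shows "integrable lborel (\<lambda>z. dil_kernel m K t x (y(l := z)))"
    and "(\<integral>z. dil_kernel m K t x (y(l := z)) \<partial>lborel) = 0"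
proof -
  define Y where "Y = restrict (\<lambda>i. y i /\<^sub>R t) {..<m}"
  have eq: "dil_kernel m K t x (y(l := z)) = t powr (- (real m * DIM('a))) * K (x /\<^sub>R t) (Y(l := z /\<^sub>R t))" for z
  proof -
    have "restrict (\<lambda>i. (y(l := z)) i /\<^sub>R t) {..<m} = Y(l := z /\<^sub>R t)"
      using l by (auto simp: Y_def restrict_def)
    then show ?thesis by (simp add: dil_kernel_def)
  qed
  have Y: "Y \<in> extensional {..<m}" by (simp add: Y_def)
  have c: "\<forall>x y i. y \<in> extensional {..<m} \<longrightarrow> i < m \<longrightarrow>
          integrable lborel (\<lambda>z. K x (y(i := z))) \<and> integral\<^sup>L lborel (\<lambda>z. K x (y(i := z))) = 0"
    using K unfolding LP_kernel_def by blast
  then have i: "integrable lborel (\<lambda>z. K (x /\<^sub>R t) (Y(l := z)))" and z: "(\<integral>z. K (x /\<^sub>R t) (Y(l := z)) \<partial>lborel) = 0"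
    using Y l by auto
  note s = lborel_integral_scale[OF i t]
  show "integrable lborel (\<lambda>z. dil_kernel m K t x (y(l := z)))"
    unfolding eq by (intro integrable_mult_right s(1))
  show "(\<integral>z. dil_kernel m K t x (y(l := z)) \<partial>lborel) = 0"
    unfolding eq by (simp add: s(2) z)
qed

text \<open>The factor \<open>t^(-mn)\<close> of the dilated kernel exactly offsets the Jacobians of
  the \<open>m\<close> rescaled weights.\<close>

lemma prod_wt_scale:
  fixes y :: "nat \<Rightarrow> 'a::euclidean_space"
  assumes t: "0 < t" and S: "0 < S"
  shows "t powr (- (real m * DIM('a))) * (\<Prod>j<m. wt e S (restrict (\<lambda>i. y i /\<^sub>R t) {..<m} j)) = (\<Prod>j<m. wt e (t * S) (y j))"
proof -
  have "(\<Prod>j<m. wt e S (restrict (\<lambda>i. y i /\<^sub>R t) {..<m} j)) = (\<Prod>j<m. t ^ DIM('a) * wt e (t * S) (y j))"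
    by (intro prod.cong) (auto simp: wt_scale[OF t S])
  also have "\<dots> = (t ^ DIM('a)) ^ m * (\<Prod>j<m. wt e (t * S) (y j))" by (simp add: prod.distrib)
  also have "(t ^ DIM('a)) ^ m = t powr (real m * DIM('a))"
    using t by (simp add: powr_realpow[symmetric] powr_powr mult.commute)
  finally show ?thesis using t by (simp add: powr_minus)
qed

text \<open>Dilation turns the scales of the two kernel bounds into \<open>t + norm x\<close> and
  \<open>norm x\<close>. The means subtracted from the \<open>f i\<close> are taken over balls of
  these radii and so vary with \<open>x\<close> and \<open>t\<close>; this is harmless, because
  \<open>multilinear_BMO\<close> re-centres separately for each kernel and the constants of
  \<open>BMO_weighted\<close> ignore the scale.\<close>

lemma LP_G_bounds:
  fixes K :: "'a::euclidean_space \<Rightarrow> (nat \<Rightarrow> 'a) \<Rightarrow> real"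
  assumes K: "LP_kernel m K" and m: "0 < m"
  obtains A d b where "0 < A" "0 < d" "0 < b"
    "\<And>f x t. (\<And>i. i < m \<Longrightarrow> in_BMO (f i)) \<Longrightarrow> 0 < t \<Longrightarrow>
       \<bar>LP_G m K t f x\<bar> \<le> A * (t / (t + norm x)) powr d * (\<Prod>i<m. BMO_norm (f i))"
    "\<And>f x t. (\<And>i. i < m \<Longrightarrow> in_BMO (f i)) \<Longrightarrow> 0 < norm x \<Longrightarrow> norm x \<le> t \<Longrightarrow>
       \<bar>LP_G m K t f x - LP_G m K t f 0\<bar> \<le> A * (norm x / t) powr b * (\<Prod>i<m. BMO_norm (f i))"
proof -
  obtain A d b where A: "0 < A" and d: "0 < d" and b: "0 < b"
    and K1: "\<And>x y. y \<in> extensional {..<m} \<Longrightarrow> off_diag m x y \<Longrightarrow>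
       \<bar>K x y\<bar> \<le> A * (1 / (1 + norm x)) powr d * (\<Prod>j<m. wt (d / m) (1 + norm x) (y j))"
    and K2: "\<And>x y. y \<in> extensional {..<m} \<Longrightarrow> off_diag m x y \<Longrightarrow> off_diag m 0 y \<Longrightarrow> 0 < norm x \<Longrightarrow> norm x \<le> 1 \<Longrightarrow>
       \<bar>K x y - K 0 y\<bar> \<le> A * norm x powr b * (\<Prod>j<m. wt (b / m) (norm x) (y j))"
    by (rule LP_kernel_bounds[OF K m]) (rule that)
  have off: "off_diag m (x /\<^sub>R t) (restrict (\<lambda>i. y i /\<^sub>R t) {..<m})" if "off_diag m x y" "0 < t" for x t and y :: "nat \<Rightarrow> 'a"
    using that by (auto simp: off_diag_def)
  have D1: "\<bar>dil_kernel m K t x y\<bar> \<le> (A * (t / (t + norm x)) powr d) * (\<Prod>j<m. wt (d / m) (t + norm x) (y j))"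
    if o: "off_diag m x y" and t: "0 < t" for t x and y :: "nat \<Rightarrow> 'a"
  proof -
    let ?Y = "restrict (\<lambda>i. y i /\<^sub>R t) {..<m}"
    have S: "0 < 1 + norm (x /\<^sub>R t)" by (intro add_pos_nonneg) auto
    have e1: "t * (1 + norm (x /\<^sub>R t)) = t + norm x" using t by (simp add: field_simps)
    have e2: "1 / (1 + norm (x /\<^sub>R t)) = t / (t + norm x)"
      using t S by (simp add: e1[symmetric])
    have "\<bar>dil_kernel m K t x y\<bar> = t powr (- (real m * DIM('a))) * \<bar>K (x /\<^sub>R t) ?Y\<bar>"
      by (simp add: dil_kernel_def abs_mult)
    also have "\<dots> \<le> t powr (- (real m * DIM('a))) * (A * (1 / (1 + norm (x /\<^sub>R t))) powr d * (\<Prod>j<m. wt (d / m) (1 + norm (x /\<^sub>R t)) (?Y j)))"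
      by (intro mult_left_mono K1 off[OF o t]) auto
    also have "\<dots> = A * (1 / (1 + norm (x /\<^sub>R t))) powr d * (t powr (- (real m * DIM('a))) * (\<Prod>j<m. wt (d / m) (1 + norm (x /\<^sub>R t)) (?Y j)))"
      by (simp only: mult_ac)
    also have "\<dots> = (A * (t / (t + norm x)) powr d) * (\<Prod>j<m. wt (d / m) (t + norm x) (y j))"
      unfolding prod_wt_scale[OF t S] e1 e2 ..
    finally show ?thesis .
  qed
  have D2: "\<bar>dil_kernel m K t x y - dil_kernel m K t 0 y\<bar> \<le> (A * (norm x / t) powr b) * (\<Prod>j<m. wt (b / m) (norm x) (y j))"
    if o: "off_diag m x y" "off_diag m 0 y" and x: "0 < norm x" "norm x \<le> t" for t x and y :: "nat \<Rightarrow> 'a"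
  proof -
    let ?Y = "restrict (\<lambda>i. y i /\<^sub>R t) {..<m}"
    have t: "0 < t" using x by (rule less_le_trans)
    have e: "norm (x /\<^sub>R t) = norm x / t" using t by (simp add: field_simps)
    have S: "0 < norm x / t" using x t by simp
    have e1: "t * (norm x / t) = norm x" using t by simp
    have o0: "off_diag m 0 ?Y" using off[OF o(2) t] by simp
    have "\<bar>dil_kernel m K t x y - dil_kernel m K t 0 y\<bar> = t powr (- (real m * DIM('a))) * \<bar>K (x /\<^sub>R t) ?Y - K 0 ?Y\<bar>"
      by (simp add: dil_kernel_def right_diff_distrib[symmetric] abs_mult)
    also have "\<dots> \<le> t powr (- (real m * DIM('a))) * (A * (norm x / t) powr b * (\<Prod>j<m. wt (b / m) (norm x / t) (?Y j)))"
      using K2[OF _ off[OF o(1) t] o0] x t unfolding e by (intro mult_left_mono) auto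
    also have "\<dots> = A * (norm x / t) powr b * (t powr (- (real m * DIM('a))) * (\<Prod>j<m. wt (b / m) (norm x / t) (?Y j)))"
      by (simp only: mult_ac)
    also have "\<dots> = (A * (norm x / t) powr b) * (\<Prod>j<m. wt (b / m) (norm x) (y j))"
      unfolding prod_wt_scale[OF t S] e1 ..
    finally show ?thesis .
  qed
  have dm: "0 < d / m" "0 < b / m" using d b m by auto
  obtain C1 where C1: "0 \<le> C1"
    "\<And>s. 0 < s \<Longrightarrow> (\<integral>\<^sup>+ y. ennreal (wt (d / m) s (y::'a)) \<partial>lborel) \<le> ennreal C1"
    "\<And>s f. 0 < s \<Longrightarrow> in_BMO f \<Longrightarrow>
      (\<integral>\<^sup>+ y. ennreal (wt (d / m) s (y::'a) * \<bar>f y - ball_avg f 0 s\<bar>) \<partial>lborel) \<le> ennreal (C1 * BMO_norm f)"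
    by (rule BMO_weighted[OF dm(1)]) (rule that)
  obtain C2 where C2: "0 \<le> C2"
    "\<And>s. 0 < s \<Longrightarrow> (\<integral>\<^sup>+ y. ennreal (wt (b / m) s (y::'a)) \<partial>lborel) \<le> ennreal C2"
    "\<And>s f. 0 < s \<Longrightarrow> in_BMO f \<Longrightarrow>
      (\<integral>\<^sup>+ y. ennreal (wt (b / m) s (y::'a) * \<bar>f y - ball_avg f 0 s\<bar>) \<partial>lborel) \<le> ennreal (C2 * BMO_norm f)"
    by (rule BMO_weighted[OF dm(2)]) (rule that)
  have G1: "integrable (tuple_measure m) (\<lambda>y. dil_kernel m K t x y * (\<Prod>i<m. f i (y i)))"
    "\<bar>LP_G m K t f x\<bar> \<le> A * (t / (t + norm x)) powr d * C1 ^ m * (\<Prod>i<m. BMO_norm (f i))"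
    if f: "\<And>i. i < m \<Longrightarrow> in_BMO (f i)" and t: "0 < t" for f x t
  proof -
    have S: "0 < t + norm x" using t by (intro add_pos_nonneg) auto
    have M: "0 \<le> A * (t / (t + norm x)) powr d" using A by simp
    have "AE y in tuple_measure m. \<bar>dil_kernel m K t x y\<bar> \<le> (A * (t / (t + norm x)) powr d) * (\<Prod>j<m. wt (d / m) (t + norm x) (y j))"
      using AE_off_diag[OF m, of x] by eventually_elim (rule D1[OF _ t])
    note B = multilinear_BMO[OF dil_kernel_section_measurable[OF K] this M S dil_kernel_cancel(2)[OF K t] C1(1) C1(2)[OF S] C1(3)[OF S] f]
    show "integrable (tuple_measure m) (\<lambda>y. dil_kernel m K t x y * (\<Prod>i<m. f i (y i)))" by (rule B(1))
    show "\<bar>LP_G m K t f x\<bar> \<le> A * (t / (t + norm x)) powr d * C1 ^ m * (\<Prod>i<m. BMO_norm (f i))"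
      unfolding LP_G_def by (rule B(2))
  qed
  have G2: "\<bar>LP_G m K t f x - LP_G m K t f 0\<bar> \<le> A * (norm x / t) powr b * C2 ^ m * (\<Prod>i<m. BMO_norm (f i))"
    if f: "\<And>i. i < m \<Longrightarrow> in_BMO (f i)" and x: "0 < norm x" "norm x \<le> t" for f x t
  proof -
    have t: "0 < t" using x by (rule less_le_trans)
    let ?k = "\<lambda>y. dil_kernel m K t x y - dil_kernel m K t 0 y"
    have k: "?k \<in> borel_measurable (tuple_measure m)"
      by (intro borel_measurable_diff dil_kernel_section_measurable K)
    have c: "(\<integral>z. ?k (y(l := z)) \<partial>lborel) = 0" if "l < m" for y l
      using dil_kernel_cancel[OF K t that] by (subst Bochner_Integration.integral_diff) auto
    have M: "0 \<le> A * (norm x / t) powr b" using A by simp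
    have AE: "AE y in tuple_measure m. \<bar>?k y\<bar> \<le> (A * (norm x / t) powr b) * (\<Prod>j<m. wt (b / m) (norm x) (y j))"
      using AE_off_diag[OF m, of x] AE_off_diag[OF m, of 0] by eventually_elim (rule D2[OF _ _ x])
    have "LP_G m K t f x - LP_G m K t f 0 = (\<integral>y. ?k y * (\<Prod>i<m. f i (y i)) \<partial>tuple_measure m)"
      unfolding LP_G_def
      by (subst Bochner_Integration.integral_diff[symmetric, OF G1(1)[OF f t] G1(1)[OF f t]])
        (auto simp: left_diff_distrib)
    then show ?thesis
      using multilinear_BMO(2)[OF k AE M x(1) c C2(1) C2(2)[OF x(1)] C2(3)[OF x(1)] f] by simp
  qed
  show ?thesis
  proof (rule that[of "A * (C1 ^ m + C2 ^ m + 1)" d b])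
    show "0 < A * (C1 ^ m + C2 ^ m + 1)" "0 < d" "0 < b" using A d b C1(1) C2(1) by (auto intro!: mult_pos_pos add_nonneg_pos)
    fix f :: "nat \<Rightarrow> 'a \<Rightarrow> real" and x :: 'a and t :: real
    assume f: "\<And>i. i < m \<Longrightarrow> in_BMO (f i)"
    have N: "0 \<le> (\<Prod>i<m. BMO_norm (f i))" using f BMO_norm_nonneg by (intro prod_nonneg) auto
    have le: "A * C1 ^ m \<le> A * (C1 ^ m + C2 ^ m + 1)" "A * C2 ^ m \<le> A * (C1 ^ m + C2 ^ m + 1)"
      using A C1(1) C2(1) by (auto intro!: mult_left_mono)
    { assume "0 < t"
      from G1(2)[OF f this, where x=x]
      have "\<bar>LP_G m K t f x\<bar> \<le> (A * C1 ^ m) * ((t / (t + norm x)) powr d * (\<Prod>i<m. BMO_norm (f i)))" by (simp only: mult_ac)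
      also have "\<dots> \<le> (A * (C1 ^ m + C2 ^ m + 1)) * ((t / (t + norm x)) powr d * (\<Prod>i<m. BMO_norm (f i)))"
        by (intro mult_right_mono le mult_nonneg_nonneg N) auto
      finally show "\<bar>LP_G m K t f x\<bar> \<le> A * (C1 ^ m + C2 ^ m + 1) * (t / (t + norm x)) powr d * (\<Prod>i<m. BMO_norm (f i))"
        by (simp only: mult.assoc) }
    { assume "0 < norm x" "norm x \<le> t"
      from G2[OF f this]
      have "\<bar>LP_G m K t f x - LP_G m K t f 0\<bar> \<le> (A * C2 ^ m) * ((norm x / t) powr b * (\<Prod>i<m. BMO_norm (f i)))" by (simp only: mult_ac)
      also have "\<dots> \<le> (A * (C1 ^ m + C2 ^ m + 1)) * ((norm x / t) powr b * (\<Prod>i<m. BMO_norm (f i)))"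
        by (intro mult_right_mono le mult_nonneg_nonneg N) auto
      finally show "\<bar>LP_G m K t f x - LP_G m K t f 0\<bar> \<le> A * (C1 ^ m + C2 ^ m + 1) * (norm x / t) powr b * (\<Prod>i<m. BMO_norm (f i))"
        by (simp only: mult.assoc) }
  qed
qed

section \<open>BLO\<close>

text \<open>On the \<open>k\<close>-th dyadic shell the logarithm is at most \<open>k + 1\<close>.
  The shell lies in a ball with at most \<open>2^(-k)\<close> of the volume, and the sum of
  \<open>(k + 1) * 2^(-k)\<close> is 4.\<close>

lemma nn_integral_ln_ball0:
  fixes s :: real
  assumes s: "0 < s"
  shows "(\<integral>\<^sup>+ x. ennreal (indicator (ball (0::'a::euclidean_space) s) x * ln (s / norm x)) \<partial>lborel)
    \<le> ennreal (4 * measure lborel (ball (0::'a) s))"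
proof -
  let ?B = "\<lambda>k::nat. ball (0::'a) (s * (1/2) ^ k)"
  have pt: "ennreal (indicator (ball (0::'a) s) x * ln (s / norm x)) \<le> (\<Sum>k. ennreal (real (Suc k)) * indicator (?B k) x)" for x :: 'a
  \<comment> \<open>At the origin the default values of division and of \<open>ln\<close> make the
    integrand 0.\<close>
  proof (cases "x = 0 \<or> s \<le> norm x")
    case True
    then have "indicator (ball (0::'a) s) x * ln (s / norm x) = 0" by (auto simp: indicator_def)
    then show ?thesis by (simp only: ennreal_0 zero_le)
  next
    case False
    then have x: "0 < norm x" "norm x < s" by auto
    obtain k0 where k0: "s / norm x < 2 ^ k0" using real_arch_pow[of 2 "s / norm x"] by auto
    \<comment> \<open>Chosen so that \<open>2^k < s / norm x <= 2^(k + 1)\<close>: the left half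
      places \<open>x\<close> in \<open>?B k\<close>, the right half bounds the logarithm by
      \<open>k + 1\<close>.\<close>
    define k where "k = (LEAST k. s / norm x \<le> 2 ^ Suc k)"
    have k: "s / norm x \<le> 2 ^ Suc k" unfolding k_def
      by (rule LeastI[of _ k0]) (use k0 power_increasing[of k0 "Suc k0" "2::real"] in linarith)
    have k': "2 ^ k < s / norm x"
    proof (cases k)
      case 0 then show ?thesis using x by simp
    next
      case (Suc j)
      then have "\<not> s / norm x \<le> 2 ^ Suc j" unfolding k_def using not_less_Least by (metis lessI)
      then show ?thesis using Suc by simp
    qed
    have xB: "x \<in> ?B k" using k' x by (simp add: power_divide field_simps)
    have "ln (s / norm x) \<le> ln (2 ^ Suc k)" using k x s by (subst ln_le_cancel_iff) auto
    also have "\<dots> = real (Suc k) * ln 2" by (subst ln_realpow) auto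
    also have "\<dots> \<le> real (Suc k) * 1" using ln_2_less_1 by (intro mult_left_mono) auto
    finally have "ennreal (indicator (ball (0::'a) s) x * ln (s / norm x)) \<le> ennreal (real (Suc k)) * indicator (?B k) x"
      using x xB by (auto intro!: ennreal_leI simp del: of_nat_Suc)
    also have "\<dots> \<le> (\<Sum>k. ennreal (real (Suc k)) * indicator (?B k) x)"
      by (rule term_le_suminf_ennreal)
    finally show ?thesis .
  qed
  have sums: "(\<lambda>k. real (Suc k) * (1/2) ^ k) sums 4"
    using geometric_deriv_sums[of "1/2::real"] by (simp add: power2_eq_square)
  have "(\<integral>\<^sup>+ x. ennreal (indicator (ball (0::'a) s) x * ln (s / norm x)) \<partial>lborel)
     \<le> (\<integral>\<^sup>+ x. (\<Sum>k. ennreal (real (Suc k)) * indicator (?B k) x) \<partial>lborel)"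
    by (intro nn_integral_mono pt)
  also have "\<dots> = (\<Sum>k. ennreal (real (Suc k)) * emeasure lborel (?B k))"
  proof (subst nn_integral_suminf)
    show "(\<lambda>x. ennreal (real (Suc k)) * indicator (?B k) x) \<in> borel_measurable lborel" for k
      by (intro borel_measurable_times_ennreal borel_measurable_const borel_measurable_indicator) auto
  qed (simp add: nn_integral_cmult_indicator del: of_nat_Suc)
  also have "\<dots> \<le> (\<Sum>k. ennreal (measure lborel (ball (0::'a) s) * (real (Suc k) * (1/2) ^ k)))"
  proof (intro suminf_le summableI)
    fix k
    have "emeasure lborel (?B k) = ennreal (measure lborel (?B k))"
      using emeasure_lborel_ball_finite[of "0::'a" "s * (1/2) ^ k"] by (intro emeasure_eq_ennreal_measure) auto
    moreover have "measure lborel (?B k) \<le> measure lborel (ball (0::'a) s) * (1/2) ^ k"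
    proof -
      \<comment> \<open>Only one of the \<open>DIM('a)\<close> factors \<open>2^(-k)\<close> is
        kept, which makes the constant 4 independent of the dimension.\<close>
      have "((1/2::real) ^ k) ^ DIM('a) \<le> ((1/2) ^ k) ^ 1"
        by (intro power_decreasing) (auto simp: Suc_leI power_le_one)
      then have "unit_ball_vol (real DIM('a)) * s ^ DIM('a) * ((1/2::real) ^ k) ^ DIM('a) \<le> unit_ball_vol (real DIM('a)) * s ^ DIM('a) * (1/2) ^ k"
        using s by (intro mult_left_mono) auto
      then show ?thesis using s by (simp add: measure_ball_lborel power_mult_distrib mult_ac)
    qed
    ultimately show "ennreal (real (Suc k)) * emeasure lborel (?B k) \<le> ennreal (measure lborel (ball (0::'a) s) * (real (Suc k) * (1/2) ^ k))"
      by (auto simp: ennreal_mult'[symmetric] mult.left_commute simp del: of_nat_Suc intro!: ennreal_leI mult_left_mono)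
  qed
  also have "\<dots> = ennreal (measure lborel (ball (0::'a) s) * 4)"
    using sums_mult[OF sums, of "measure lborel (ball (0::'a) s)"]
    by (intro suminf_ennreal_eq) auto
  finally show ?thesis by (simp add: mult.commute)
qed

text \<open>If \<open>s = norm c + r\<close> is at most \<open>4 r\<close>, the ball is enlarged to
  the centred one of radius \<open>s\<close>, at the price of \<open>4^DIM('a)\<close> in volume.
  Any other ball stays away from the origin: \<open>s <= norm x + 2 r\<close> and
  \<open>2 r < s / 2\<close> give \<open>s <= 2 * norm x\<close>, so the logarithm is at most
  \<open>ln 2\<close>.\<close>

lemma nn_integral_ln_ball:
  fixes c :: "'a::euclidean_space"
  assumes r: "0 < r"
  shows "(\<integral>\<^sup>+ x. ennreal (indicator (ball c r) x * ln ((norm c + r) / norm x)) \<partial>lborel)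
    \<le> ennreal (4 * 4 ^ DIM('a) * measure lborel (ball c r))"
proof -
  define s where "s = norm c + r"
  have s: "0 < s" using r by (simp add: s_def add_nonneg_pos)
  have sub: "norm x < s" if "x \<in> ball c r" for x
    using that norm_triangle_ineq2[of x c] by (simp add: s_def dist_norm norm_minus_commute)
  have ln0: "0 \<le> ln (s / norm x)" if "norm x < s" for x :: 'a
    using that by (cases "x = 0") (auto intro!: ln_ge_zero)
  show ?thesis unfolding s_def[symmetric]
  proof (cases "s \<le> 4 * r")
    case True
    have "(\<integral>\<^sup>+ x. ennreal (indicator (ball c r) x * ln (s / norm x)) \<partial>lborel) \<le>
      (\<integral>\<^sup>+ x. ennreal (indicator (ball (0::'a) s) x * ln (s / norm x)) \<partial>lborel)"
    proof (intro nn_integral_mono ennreal_leI)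
      fix x
      show "indicator (ball c r) x * ln (s / norm x) \<le> indicator (ball 0 s) x * ln (s / norm x)"
        using sub[of x] ln0[of x] by (cases "x \<in> ball c r") (auto simp: indicator_def)
    qed
    also have "\<dots> \<le> ennreal (4 * measure lborel (ball (0::'a) s))" by (rule nn_integral_ln_ball0[OF s])
    also have "\<dots> \<le> ennreal (4 * 4 ^ DIM('a) * measure lborel (ball c r))"
    proof (intro ennreal_leI)
      have "s ^ DIM('a) \<le> (4 * r) ^ DIM('a)" using True s by (intro power_mono) auto
      then have "unit_ball_vol (real DIM('a)) * s ^ DIM('a) \<le> unit_ball_vol (real DIM('a)) * (4 * r) ^ DIM('a)"
        by (intro mult_left_mono) auto
      then show "4 * measure lborel (ball (0::'a) s) \<le> 4 * 4 ^ DIM('a) * measure lborel (ball c r)"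
        using s r by (simp add: measure_ball_lborel power_mult_distrib mult_ac)
    qed
    finally show "(\<integral>\<^sup>+ x. ennreal (indicator (ball c r) x * ln (s / norm x)) \<partial>lborel)
      \<le> ennreal (4 * 4 ^ DIM('a) * measure lborel (ball c r))" .
  next
    case False
    have le1: "ln (s / norm x) \<le> 1" if "x \<in> ball c r" for x
    proof -
      have "norm c \<le> norm x + norm (c - x)" using norm_triangle_ineq[of x "c - x"] by simp
      then have "s \<le> 2 * norm x" using that False by (simp add: s_def dist_norm)
      moreover from this have "0 < norm x" using s by linarith
      ultimately have "ln (s / norm x) \<le> ln 2" using s by (subst ln_le_cancel_iff) (auto simp: field_simps)
      then show ?thesis using ln_2_less_1 by simp
    qed
    have "(\<integral>\<^sup>+ x. ennreal (indicator (ball c r) x * ln (s / norm x)) \<partial>lborel) \<le> (\<integral>\<^sup>+ x. indicator (ball c r) x \<partial>lborel)"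
      by (intro nn_integral_mono) (auto simp: indicator_def le1 ennreal_le_1)
    also have "\<dots> = ennreal (measure lborel (ball c r))"
      using emeasure_lborel_ball_finite[of c r] by (simp, intro emeasure_eq_ennreal_measure) auto
    also have "\<dots> \<le> ennreal (4 * 4 ^ DIM('a) * measure lborel (ball c r))"
    proof (intro ennreal_leI)
      have "(1::real) \<le> 4 ^ DIM('a)" by simp
      then have "(1::real) \<le> 4 * 4 ^ DIM('a)" by linarith
      from mult_right_mono[OF this, of "measure lborel (ball c r)"]
      show "measure lborel (ball c r) \<le> 4 * 4 ^ DIM('a) * measure lborel (ball c r)" by simp
    qed
    finally show "(\<integral>\<^sup>+ x. ennreal (indicator (ball c r) x * ln (s / norm x)) \<partial>lborel)
      \<le> ennreal (4 * 4 ^ DIM('a) * measure lborel (ball c r))" .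
  qed
qed

lemma set_integral_ln_ball:
  fixes c :: "'a::euclidean_space"
  assumes r: "0 < r"
  shows "set_integrable lborel (ball c r) (\<lambda>x. ln ((norm c + r) / norm x))"
    and "(\<integral>x\<in>ball c r. ln ((norm c + r) / norm x) \<partial>lborel) \<le> 4 * 4 ^ DIM('a) * measure lborel (ball c r)"
proof -
  let ?f = "\<lambda>x. indicator (ball c r) x * ln ((norm c + r) / norm x)"
  have f0: "0 \<le> ?f x" for x
  proof (cases "x \<in> ball c r \<and> x \<noteq> 0")
    case True
    then have "norm x < norm c + r" using norm_triangle_ineq2[of x c] by (simp add: dist_norm norm_minus_commute)
    then show ?thesis using True by (auto intro!: ln_ge_zero)
  qed (auto simp: indicator_def)
  have "(\<lambda>x::'a. ln ((norm c + r) / norm x)) \<in> borel_measurable borel" by measurable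
  then have m: "?f \<in> borel_measurable lborel"
    by (intro borel_measurable_times borel_measurable_indicator) auto
  have i: "integrable lborel ?f"
    using m f0 nn_integral_ln_ball[OF r, of c] by (intro integrableI_nonneg) (auto intro: le_less_trans)
  then show "set_integrable lborel (ball c r) (\<lambda>x. ln ((norm c + r) / norm x))"
    by (simp add: set_integrable_def)
  have "ennreal (\<integral>x. ?f x \<partial>lborel) \<le> ennreal (4 * 4 ^ DIM('a) * measure lborel (ball c r))"
    using nn_integral_ln_ball[OF r, of c] by (subst nn_integral_eq_integral[symmetric, OF i]) (auto simp: f0)
  then show "(\<integral>x\<in>ball c r. ln ((norm c + r) / norm x) \<partial>lborel) \<le> 4 * 4 ^ DIM('a) * measure lborel (ball c r)"
    by (subst (asm) ennreal_le_iff) (auto simp: set_lebesgue_integral_def)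
qed

text \<open>For \<open>ball c r\<close> use the \<open>a\<close> belonging to
  \<open>s = norm c + r\<close>. It lies below the essential infimum, the origin being null, so the
  mean excess is at most \<open>M\<close> times the mean of
  \<open>2 + ln (s / norm x)\<close>.\<close>

lemma BLO_boundI:
  fixes H :: "'a::euclidean_space \<Rightarrow> real"
  assumes H: "H \<in> borel_measurable borel" and M: "0 \<le> M"
    and osc: "\<And>s. 0 < s \<Longrightarrow> \<exists>a. \<forall>x. x \<noteq> 0 \<longrightarrow> norm x < s \<longrightarrow> a \<le> H x \<and> H x \<le> a + M * (2 + ln (s / norm x))"
  shows "BLO_bound H (M * (2 + 4 * 4 ^ DIM('a)))"
  unfolding BLO_bound_def
proof (intro allI impI)
  fix c :: 'a and r :: real assume r: "0 < r"
  define s where "s = norm c + r"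
  have s: "0 < s" using r by (simp add: s_def add_nonneg_pos)
  have sub: "norm x < s" if "x \<in> ball c r" for x
    using that norm_triangle_ineq2[of x c] by (simp add: s_def dist_norm norm_minus_commute)
  obtain a where a: "\<And>x. x \<noteq> 0 \<Longrightarrow> norm x < s \<Longrightarrow> a \<le> H x \<and> H x \<le> a + M * (2 + ln (s / norm x))"
    using osc[OF s] by blast
  let ?B = "ball c r" and ?E = "ess_inf_on (ball c r) H" and ?l = "\<lambda>x. ln (s / norm x)"
  have V: "0 < measure lborel ?B" using content_ball_pos[OF r, of c] by simp
  have ne0: "AE x in lborel. x \<noteq> (0::'a)" by (rule AE_lborel_singleton)
  have li: "set_integrable lborel ?B ?l" and lb: "(\<integral>x\<in>?B. ?l x \<partial>lborel) \<le> 4 * 4 ^ DIM('a) * measure lborel ?B"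
    unfolding s_def by (rule set_integral_ln_ball[OF r])+
  have ui: "set_integrable lborel ?B (\<lambda>x. u + M * (2 + ?l x))" for u
    by (intro set_integral_add set_integrable_const_ball set_integrable_mult_right li)
  have Hi: "set_integrable lborel ?B H"
    unfolding set_integrable_def
  proof (rule Bochner_Integration.integrable_bound)
    show "integrable lborel (\<lambda>x. indicator ?B x *\<^sub>R (\<bar>a\<bar> + M * (2 + ?l x)))"
      using ui[of "\<bar>a\<bar>"] by (simp add: set_integrable_def)
    show "(\<lambda>x. indicator ?B x *\<^sub>R H x) \<in> borel_measurable lborel"
      using H by (intro borel_measurable_scaleR borel_measurable_indicator) auto
    show "AE x in lborel. norm (indicator ?B x *\<^sub>R H x) \<le> norm (indicator ?B x *\<^sub>R (\<bar>a\<bar> + M * (2 + ?l x)))"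
      using ne0
    proof eventually_elim
      case (elim x)
      show ?case
      proof (cases "x \<in> ?B")
        case True
        then have "0 \<le> M * (2 + ?l x)"
          using M elim sub[OF True] by (intro mult_nonneg_nonneg add_nonneg_nonneg ln_ge_zero) auto
        with True a[OF elim sub[OF True]] show ?thesis by (simp only: indicator_simps real_norm_def scaleR_one) arith
      qed simp
    qed
  qed
  have aE: "ereal a \<le> ?E" unfolding ess_inf_on_def
    by (intro Sup_upper) (use ne0 a sub in \<open>auto elim!: eventually_mono\<close>)
  \<comment> \<open>\<open>real_of_ereal\<close> sends infinity to 0, so an infinite essential
    infimum has to be ruled out: it would force the ball to be null.\<close>
  have Einf: "?E \<noteq> \<infinity>"
  proof
    assume E: "?E = \<infinity>"
    have "AE x in lborel. x \<in> ?B \<longrightarrow> ereal (real k) \<le> ereal (H x)" for k :: nat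
    proof -
      have "ereal (real k) < ?E" using E by simp
      then obtain z where "AE x in lborel. x \<in> ?B \<longrightarrow> z \<le> ereal (H x)" "ereal (real k) < z"
        unfolding ess_inf_on_def less_Sup_iff by auto
      then show ?thesis by (elim eventually_mono) (meson less_imp_le order_trans)
    qed
    then have "AE x in lborel. \<forall>k::nat. x \<in> ?B \<longrightarrow> ereal (real k) \<le> ereal (H x)"
      by (subst AE_all_countable) auto
    then have "AE x in lborel. x \<notin> ?B"
    proof eventually_elim
      case (elim x)
      obtain k :: nat where "H x < real k" using reals_Archimedean2 by blast
      then show ?case using elim[rule_format, of k] by auto
    qed
    then have "emeasure lborel ?B = 0" by (subst (asm) AE_iff_measurable[of ?B]) auto
    then show False using V by (simp add: measure_def)
  qed
  have E: "a \<le> real_of_ereal ?E" using aE Einf by (cases ?E) auto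
  have "(\<integral>x\<in>?B. H x - real_of_ereal ?E \<partial>lborel) \<le> (\<integral>x\<in>?B. 0 + M * (2 + ?l x) \<partial>lborel)"
    unfolding set_lebesgue_integral_def
  proof (rule integral_mono_AE)
    show "integrable lborel (\<lambda>x. indicator ?B x *\<^sub>R (H x - real_of_ereal ?E))"
      using set_integral_diff(1)[OF Hi set_integrable_const_ball] by (simp add: set_integrable_def)
    show "integrable lborel (\<lambda>x. indicator ?B x *\<^sub>R (0 + M * (2 + ?l x)))"
      using ui[of 0] by (simp add: set_integrable_def)
    show "AE x in lborel. indicator ?B x *\<^sub>R (H x - real_of_ereal ?E) \<le> indicator ?B x *\<^sub>R (0 + M * (2 + ?l x))"
      using ne0
    proof eventually_elim
      case (elim x)
      show ?case
      proof (cases "x \<in> ?B")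
        case True
        with a[OF elim sub[OF True]] E show ?thesis by simp
      qed simp
    qed
  qed
  also have "\<dots> = M * (\<integral>x\<in>?B. 2 + ?l x \<partial>lborel)" by simp
  also have "\<dots> = M * (2 * measure lborel ?B + (\<integral>x\<in>?B. ?l x \<partial>lborel))"
    by (subst set_integral_add(2)[OF set_integrable_const_ball li]) (simp add: set_integral_const_ball)
  also have "\<dots> \<le> M * (2 * measure lborel ?B + 4 * 4 ^ DIM('a) * measure lborel ?B)"
    using lb M by (intro mult_left_mono) auto
  finally have "ball_avg (\<lambda>x. H x - real_of_ereal ?E) c r \<le> M * (2 + 4 * 4 ^ DIM('a))"
    using V unfolding ball_avg_def by (simp add: field_simps)
  moreover have "?E \<noteq> - \<infinity>" using aE by auto
  ultimately show "set_integrable lborel ?B H \<and> ?E \<noteq> - \<infinity> \<and>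
      ball_avg (\<lambda>x. H x - real_of_ereal ?E) c r \<le> M * (2 + 4 * 4 ^ DIM('a))"
    using Hi by blast
qed

text \<open>An infimum of reals needs a set bounded below; the mean excess over the unit ball is a
  lower bound for all admissible constants.\<close>

lemma BLO_norm_le: "BLO_bound F C \<Longrightarrow> BLO_norm F \<le> C"
  unfolding BLO_norm_def
  by (rule cInf_lower)
    (auto intro!: bdd_belowI[of _ "ball_avg (\<lambda>x. F x - real_of_ereal (ess_inf_on (ball 0 1) F)) 0 1"] simp: BLO_bound_def)

section \<open>Square functions\<close>

text \<open>The measure \<open>dt/t\<close> is dilation invariant, so neither half depends on
  \<open>r\<close>: the part below \<open>r\<close> gives \<open>1 / (2 d)\<close> and the part
  above gives \<open>2 / b\<close>.\<close>

lemma nn_integral_powr_weights: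
  fixes r d b :: real
  assumes r: "0 < r" and d: "0 < d" and b: "0 < b"
  shows "(\<integral>\<^sup>+ t. ennreal (indicator {0..r} t * ((t / r) powr (2 * d) / t) + indicator {r..} t * (2 * (r / t) powr b / t)) \<partial>lborel)
    = ennreal (1 / (2 * d) + 2 / b)"
proof -
  have i1: "((\<lambda>t. t powr (2 * d - 1)) has_integral (r powr (2 * d) / (2 * d))) {0..r}"
    using has_integral_powr_from_0[of "2 * d - 1" r] r d by simp
  have n1: "(\<integral>\<^sup>+ t. ennreal (indicator {0..r} t * ((t / r) powr (2 * d) / t)) \<partial>lborel) = ennreal (1 / (2 * d))"
  proof -
    have "((\<lambda>t. (t / r) powr (2 * d) / t) has_integral 1 / (2 * d)) {0..r}"
    proof (rule has_integral_eq)
      show "((\<lambda>t. r powr (- (2 * d)) * t powr (2 * d - 1)) has_integral 1 / (2 * d)) {0..r}"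
      proof -
        have "r powr (- (2 * d)) * (r powr (2 * d) / (2 * d)) = 1 / (2 * d)" using r by (simp add: powr_minus)
        then show ?thesis using has_integral_mult_right[OF i1, of "r powr (- (2 * d))"] by (simp only:)
      qed
      show "r powr (- (2 * d)) * t powr (2 * d - 1) = (t / r) powr (2 * d) / t" if "t \<in> {0..r}" for t
        using that r by (cases "t = 0") (auto simp: powr_diff powr_minus powr_divide divide_simps)
    qed
    then show ?thesis by (intro nn_integral_has_integral_lebesgue) auto
  qed
  have i2: "((\<lambda>t. t powr (- b - 1)) has_integral (r powr (- b) / b)) {r..}"
    using has_integral_powr_to_inf[of "- b - 1" r] r b by simp
  have n2: "(\<integral>\<^sup>+ t. ennreal (indicator {r..} t * (2 * (r / t) powr b / t)) \<partial>lborel) = ennreal (2 / b)"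
  proof -
    have "((\<lambda>t. 2 * (r / t) powr b / t) has_integral 2 / b) {r..}"
    proof (rule has_integral_eq)
      show "((\<lambda>t. (2 * r powr b) * t powr (- b - 1)) has_integral 2 / b) {r..}"
      proof -
        have "2 * r powr b * (r powr (- b) / b) = 2 / b" using r by (simp add: powr_minus)
        then show ?thesis using has_integral_mult_right[OF i2, of "2 * r powr b"] by (simp only:)
      qed
      show "(2 * r powr b) * t powr (- b - 1) = 2 * (r / t) powr b / t" if "t \<in> {r..}" for t
        using that r by (auto simp: powr_diff powr_minus powr_divide divide_simps)
    qed
    then show ?thesis using r by (intro nn_integral_has_integral_lebesgue) auto
  qed
  have nonneg: "0 \<le> indicator {0..r} t * ((t / r) powr (2 * d) / t)" "0 \<le> indicator {r..} t * (2 * (r / t) powr b / t)" for t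
    using r by (auto simp: indicator_def)
  have "(\<lambda>t. indicator {0..r} t * ((t / r) powr (2 * d) / t)) \<in> borel_measurable borel"
    "(\<lambda>t. indicator {r..} t * (2 * (r / t) powr b / t)) \<in> borel_measurable borel"
    by measurable
  then have "(\<integral>\<^sup>+ t. ennreal (indicator {0..r} t * ((t / r) powr (2 * d) / t) + indicator {r..} t * (2 * (r / t) powr b / t)) \<partial>lborel)
    = ennreal (1 / (2 * d)) + ennreal (2 / b)"
    unfolding n1[symmetric] n2[symmetric] ennreal_plus[OF nonneg]
    by (intro nn_integral_add) auto
  also have "\<dots> = ennreal (1 / (2 * d) + 2 / b)" using d b by (intro ennreal_plus[symmetric]) auto
  finally show ?thesis .
qed

text \<open>In the locale, \<open>G t x\<close> is almost constant in \<open>x\<close> on \<open>norm x \<le> t\<close> and small for \<open>t \<le> norm x\<close>,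
  so \<open>sq x\<close> agrees up to \<open>O(Q\<^sup>2)\<close> with the tail integral \<open>tail (norm x)\<close> at the origin, which
  grows at most logarithmically.\<close>

locale square_function =
  fixes G :: "real \<Rightarrow> 'a::euclidean_space \<Rightarrow> real" and Q d b :: real
  assumes G_meas: "(\<lambda>(t, x). G t x) \<in> borel_measurable (borel \<Otimes>\<^sub>M borel)"
    and Q: "0 < Q" and d: "0 < d" and b: "0 < b"
    and size: "\<And>t x. 0 < t \<Longrightarrow> \<bar>G t x\<bar> \<le> Q * (t / (t + norm x)) powr d"
    and diff: "\<And>t x. 0 < norm x \<Longrightarrow> norm x \<le> t \<Longrightarrow> \<bar>G t x - G t 0\<bar> \<le> Q * (norm x / t) powr b"
begin

definition sq :: "'a \<Rightarrow> ennreal" where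
  "sq x = (\<integral>\<^sup>+ t. indicator {0<..} t * ennreal ((G t x)\<^sup>2 / t) \<partial>lborel)"

definition tail :: "real \<Rightarrow> ennreal" where
  "tail r = (\<integral>\<^sup>+ t. indicator {r<..} t * ennreal ((G t 0)\<^sup>2 / t) \<partial>lborel)"

definition E :: real where "E = 1 / (2 * d) + 2 / b"

lemma E_pos: "0 < E" using d b by (simp add: E_def add_pos_pos)

text \<open>Up to the factor \<open>Q^2\<close>, the pointwise error in replacing \<open>sq\<close>
  by \<open>tail\<close>: below \<open>r\<close> the squared size bound, above \<open>r\<close> a
  difference of squares, where the 2 comes from \<open>|G t x + G t 0| <= 2 Q\<close>.\<close>

definition wgt :: "real \<Rightarrow> real \<Rightarrow> real" where
  "wgt r t = indicator {0..r} t * ((t / r) powr (2 * d) / t) + indicator {r..} t * (2 * (r / t) powr b / t)"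

lemma wgt_measurable: "wgt r \<in> borel_measurable borel"
  unfolding wgt_def[abs_def] by measurable

lemma wgt_nonneg: "0 < r \<Longrightarrow> 0 \<le> wgt r t"
  by (auto simp: wgt_def indicator_def)

lemma wgt_integral:
  assumes "0 < r"
  shows "(\<integral>\<^sup>+ t. ennreal (Q\<^sup>2 * wgt r t) \<partial>lborel) = ennreal (Q\<^sup>2 * E)"
proof -
  have "(\<integral>\<^sup>+ t. ennreal (Q\<^sup>2 * wgt r t) \<partial>lborel) = ennreal (Q\<^sup>2) * (\<integral>\<^sup>+ t. ennreal (wgt r t) \<partial>lborel)"
    using wgt_measurable[of r] by (subst nn_integral_cmult[symmetric]) (auto simp: ennreal_mult')
  also have "(\<integral>\<^sup>+ t. ennreal (wgt r t) \<partial>lborel) = ennreal E"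
    unfolding wgt_def E_def by (rule nn_integral_powr_weights[OF assms d b])
  finally show ?thesis by (simp add: ennreal_mult')
qed

lemma G_section: "(\<lambda>t. G t x) \<in> borel_measurable borel"
  using measurable_compose[OF measurable_Pair2'[of x borel borel] G_meas] by simp

lemma integrand_measurable: "(\<lambda>t. indicator {r<..} t * ennreal ((G t x)\<^sup>2 / t)) \<in> borel_measurable lborel"
proof -
  have [measurable]: "(\<lambda>t. G t x) \<in> borel_measurable borel" by (rule G_section)
  have "(\<lambda>t. indicator {r<..} t * ennreal ((G t x)\<^sup>2 / t)) \<in> borel_measurable borel" by measurable
  then show ?thesis by simp
qed

lemma size_le: assumes "0 < t" shows "\<bar>G t x\<bar> \<le> Q"
proof -
  have "(t / (t + norm x)) powr d \<le> 1"
    using assms d by (intro powr_le1) (auto simp: divide_le_eq_1 add_nonneg_nonneg add_pos_nonneg)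
  from mult_left_mono[OF this, of Q] have "Q * (t / (t + norm x)) powr d \<le> Q" using Q by simp
  then show ?thesis by (rule order_trans[OF size[OF assms]])
qed

lemma near_compare:
  assumes x: "0 < norm x" and t: "norm x < t"
  shows "\<bar>(G t x)\<^sup>2 / t - (G t 0)\<^sup>2 / t\<bar> \<le> Q\<^sup>2 * wgt (norm x) t"
proof -
  have t0: "0 < t" using x t by (rule less_trans)
  have "\<bar>(G t x)\<^sup>2 - (G t 0)\<^sup>2\<bar> = \<bar>G t x - G t 0\<bar> * \<bar>G t x + G t 0\<bar>"
    by (simp add: power2_eq_square abs_mult[symmetric] algebra_simps)
  also have "\<dots> \<le> (Q * (norm x / t) powr b) * (2 * Q)"
    using diff[OF x, of t] size_le[OF t0, of x] size_le[OF t0, of 0] t Q by (intro mult_mono) auto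
  also have "\<dots> = Q\<^sup>2 * (2 * (norm x / t) powr b)" by (simp add: power2_eq_square)
  finally have "\<bar>(G t x)\<^sup>2 - (G t 0)\<^sup>2\<bar> / t \<le> Q\<^sup>2 * (2 * (norm x / t) powr b) / t"
    using t0 by (intro divide_right_mono) auto
  also have "\<dots> = Q\<^sup>2 * wgt (norm x) t" using t by (simp add: wgt_def indicator_def)
  finally show ?thesis using t0 by (simp add: diff_divide_distrib[symmetric])
qed

lemma far_compare:
  assumes t: "0 < t" "t \<le> norm x"
  shows "(G t x)\<^sup>2 / t \<le> Q\<^sup>2 * wgt (norm x) t"
proof -
  have x: "0 < norm x" using t by linarith
  have "(t / (t + norm x)) powr d \<le> (t / norm x) powr d"
    using t x d by (intro powr_mono2 divide_left_mono) auto
  then have "\<bar>G t x\<bar> \<le> Q * (t / norm x) powr d"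
    using size[OF t(1), of x] Q by (meson mult_left_mono less_imp_le order_trans)
  from power_mono[OF this, of 2] have "(G t x)\<^sup>2 \<le> (Q * (t / norm x) powr d)\<^sup>2" by simp
  also have "\<dots> = Q\<^sup>2 * (t / norm x) powr (2 * d)"
    by (simp add: power_mult_distrib power2_eq_square[of "_ powr _"] powr_add[symmetric])
  finally have "(G t x)\<^sup>2 / t \<le> Q\<^sup>2 * (t / norm x) powr (2 * d) / t" using t by (intro divide_right_mono) auto
  also have "\<dots> = Q\<^sup>2 * ((t / norm x) powr (2 * d) / t)" by simp
  also have "\<dots> \<le> Q\<^sup>2 * wgt (norm x) t"
    using t by (intro mult_left_mono) (auto simp: wgt_def indicator_def)
  finally show ?thesis .
qed

lemma integrand_compare:
  assumes x: "0 < norm x"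
  shows "indicator {0<..} t * ennreal ((G t x)\<^sup>2 / t)
      \<le> indicator {norm x<..} t * ennreal ((G t 0)\<^sup>2 / t) + ennreal (Q\<^sup>2 * wgt (norm x) t)" (is ?A)
    and "indicator {norm x<..} t * ennreal ((G t 0)\<^sup>2 / t)
      \<le> indicator {0<..} t * ennreal ((G t x)\<^sup>2 / t) + ennreal (Q\<^sup>2 * wgt (norm x) t)" (is ?B)
proof -
  have w: "0 \<le> Q\<^sup>2 * wgt (norm x) t" using wgt_nonneg[OF x] by simp
  consider "t \<le> 0" | "0 < t" "t \<le> norm x" | "0 < t" "norm x < t" by linarith
  then have "?A \<and> ?B"
  proof cases
    case 1
    then have "\<not> norm x < t" using x by linarith
    then show ?thesis using 1 by simp
  next
    case 2
    then show ?thesis using far_compare[OF 2] by (auto intro!: ennreal_leI)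
  next
    case 3
    have "(G t x)\<^sup>2 / t \<le> (G t 0)\<^sup>2 / t + Q\<^sup>2 * wgt (norm x) t"
      "(G t 0)\<^sup>2 / t \<le> (G t x)\<^sup>2 / t + Q\<^sup>2 * wgt (norm x) t"
      using near_compare[OF x 3(2)] by (auto simp: abs_le_iff)
    from this[THEN ennreal_leI] show ?thesis using 3 w by (simp add: ennreal_plus)
  qed
  then show ?A ?B by auto
qed

text \<open>Stated additively in \<open>ennreal\<close>, without subtraction, so that each
  inequality also transfers finiteness or infinity from one side to the other.\<close>

lemma sq_tail_compare:
  assumes x: "x \<noteq> 0"
  shows "sq x \<le> tail (norm x) + ennreal (Q\<^sup>2 * E)" and "tail (norm x) \<le> sq x + ennreal (Q\<^sup>2 * E)"
proof -
  have x: "0 < norm x" using x by simp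
  have wm: "(\<lambda>t. ennreal (Q\<^sup>2 * wgt (norm x) t)) \<in> borel_measurable lborel"
    using wgt_measurable[of "norm x"] by simp
  note add = nn_integral_add[OF integrand_measurable wm, symmetric]
  show "sq x \<le> tail (norm x) + ennreal (Q\<^sup>2 * E)"
    unfolding sq_def tail_def wgt_integral[OF x, symmetric] add
    by (intro nn_integral_mono integrand_compare(1) x)
  show "tail (norm x) \<le> sq x + ennreal (Q\<^sup>2 * E)"
    unfolding sq_def tail_def wgt_integral[OF x, symmetric] add
    by (intro nn_integral_mono integrand_compare(2) x)
qed

lemma tail_antimono: "r \<le> s \<Longrightarrow> tail s \<le> tail r"
  unfolding tail_def by (intro nn_integral_mono mult_right_mono) (auto simp: indicator_def)

text \<open>For \<open>t\<close> between \<open>r\<close> and \<open>s\<close> the integrand is at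
  most \<open>Q^2 / t\<close>, by the uniform bound on \<open>G\<close>.\<close>

lemma tail_log:
  assumes r: "0 < r" and s: "r \<le> s"
  shows "tail r \<le> tail s + ennreal (Q\<^sup>2 * ln (s / r))"
proof -
  have "((\<lambda>t. Q\<^sup>2 * (1 / t)) has_integral Q\<^sup>2 * (ln s - ln r)) {r..s}"
    using r s by (intro has_integral_mult_right fundamental_theorem_of_calculus)
      (auto intro!: derivative_eq_intros simp: has_real_derivative_iff_has_vector_derivative[symmetric])
  then have i: "(\<integral>\<^sup>+ t. ennreal (indicator {r..s} t * (Q\<^sup>2 * (1 / t))) \<partial>lborel) = ennreal (Q\<^sup>2 * (ln s - ln r))"
    using r by (intro nn_integral_has_integral_lebesgue) auto
  have m: "(\<lambda>t. ennreal (indicator {r..s} t * (Q\<^sup>2 * (1 / t)))) \<in> borel_measurable lborel"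
  proof -
    have "(\<lambda>t::real. ennreal (indicator {r..s} t * (Q\<^sup>2 * (1 / t)))) \<in> borel_measurable borel" by measurable
    then show ?thesis by simp
  qed
  have "tail r \<le> (\<integral>\<^sup>+ t. indicator {s<..} t * ennreal ((G t 0)\<^sup>2 / t) + ennreal (indicator {r..s} t * (Q\<^sup>2 * (1 / t))) \<partial>lborel)"
    unfolding tail_def
  proof (intro nn_integral_mono)
    fix t
    show "indicator {r<..} t * ennreal ((G t 0)\<^sup>2 / t) \<le> indicator {s<..} t * ennreal ((G t 0)\<^sup>2 / t) + ennreal (indicator {r..s} t * (Q\<^sup>2 * (1 / t)))"
    proof (cases "r < t \<and> t \<le> s")
      case True
      then have t: "0 < t" using r by linarith
      have "(G t 0)\<^sup>2 \<le> Q\<^sup>2" using power_mono[OF size_le[OF t, of 0], of 2] by simp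
      then show ?thesis using True t by (auto intro!: ennreal_leI divide_right_mono)
    qed (auto simp: indicator_def)
  qed
  also have "\<dots> = tail s + ennreal (Q\<^sup>2 * (ln s - ln r))"
    unfolding tail_def i[symmetric] by (rule nn_integral_add[OF integrand_measurable m])
  finally show ?thesis using r s by (simp add: ln_div)
qed

text \<open>Tails at positive radii differ by finite amounts, so one infinite tail makes all of them
  infinite. The origin is outside the reach of \<open>sq_tail_compare\<close>, but there
  \<open>sq\<close> dominates \<open>tail 1\<close> directly.\<close>

lemma tail_infinite:
  assumes "tail 1 = \<infinity>" shows "sq x = \<infinity>"
proof (cases "x = 0")
  case True
  have "tail 1 \<le> sq 0"
    unfolding tail_def sq_def by (intro nn_integral_mono mult_right_mono) (auto simp: indicator_def)
  then show ?thesis using assms True by (simp add: top_unique)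
next
  case False
  define s where "s = max 1 (norm x)"
  have "\<infinity> \<le> tail s + ennreal (Q\<^sup>2 * ln (s / 1))"
    unfolding assms[symmetric] by (rule tail_log) (auto simp: s_def)
  then have "tail s = \<infinity>" by (simp add: top_unique ennreal_add_eq_top)
  moreover have "tail s \<le> tail (norm x)" by (rule tail_antimono) (simp add: s_def)
  ultimately have "tail (norm x) = \<infinity>" by (simp add: top_unique)
  then show ?thesis using sq_tail_compare(2)[OF False] by (simp add: top_unique ennreal_add_eq_top)
qed

lemma tail_finite:
  assumes "tail 1 \<noteq> \<infinity>" "0 < r" shows "tail r < \<infinity>"
proof (cases "r \<le> 1")
  case True
  then have "tail r \<le> tail 1 + ennreal (Q\<^sup>2 * ln (1 / r))" using assms by (intro tail_log) auto
  also have "\<dots> < \<infinity>" using assms by (simp add: less_top)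
  finally show ?thesis .
next
  case False
  then have "tail r \<le> tail 1" by (intro tail_antimono) auto
  then show ?thesis using assms by (auto simp: less_top intro: le_less_trans)
qed

text \<open>The origin is excluded because at \<open>x = 0\<close> the size bound gives no decay as
  \<open>t\<close> tends to 0, and \<open>sq 0\<close> is not controlled.\<close>

lemma sq_finite:
  assumes "tail 1 \<noteq> \<infinity>" "x \<noteq> 0" shows "sq x < \<infinity>"
proof -
  have "tail (norm x) < \<infinity>" using assms by (intro tail_finite) auto
  then show ?thesis using sq_tail_compare(1)[OF assms(2)] by (auto intro: le_less_trans simp: less_top)
qed

lemma sq_measurable: "(\<lambda>x. enn2real (sq x)) \<in> borel_measurable borel"
proof -
  have [measurable]: "(\<lambda>p. G (snd p) (fst p)) \<in> borel_measurable ((borel :: 'a measure) \<Otimes>\<^sub>M (borel :: real measure))"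
    using measurable_compose[OF measurable_Pair[OF measurable_snd measurable_fst] G_meas] by simp
  have "(\<lambda>p. indicator {0<..} (snd p) * ennreal ((G (snd p) (fst p))\<^sup>2 / snd p))
      \<in> borel_measurable ((borel :: 'a measure) \<Otimes>\<^sub>M (borel :: real measure))" by measurable
  then have "(\<lambda>(x, t). indicator {0<..} t * ennreal ((G t x)\<^sup>2 / t)) \<in> borel_measurable ((borel :: 'a measure) \<Otimes>\<^sub>M (lborel :: real measure))"
    by (simp add: case_prod_beta' cong: measurable_cong_sets sets_pair_measure_cong)
  from lborel.borel_measurable_nn_integral[OF this]
  have "sq \<in> borel_measurable borel" unfolding sq_def[abs_def] by simp
  then show ?thesis by measurable
qed

lemma sq_oscillation:
  assumes fin: "tail 1 \<noteq> \<infinity>" and s: "0 < s"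
  obtains a where "\<And>x. x \<noteq> 0 \<Longrightarrow> norm x < s \<Longrightarrow>
    a \<le> enn2real (sq x) \<and> enn2real (sq x) \<le> a + Q\<^sup>2 * (2 * E + ln (s / norm x))"
\<comment> \<open>The lower bound is the tail at the rim less the comparison error. Climbing from it
  to the tail plus that error costs the error twice, whence \<open>2 * E\<close>.\<close>
proof (rule that[of "enn2real (tail s) - Q\<^sup>2 * E"])
  fix x :: 'a assume x: "x \<noteq> 0" "norm x < s"
  have f: "sq x < \<infinity>" "tail (norm x) < \<infinity>" "tail s < \<infinity>"
    using sq_finite[OF fin x(1)] tail_finite[OF fin] s x by auto
  have QE: "0 \<le> Q\<^sup>2 * E" using E_pos by simp
  have l: "0 \<le> Q\<^sup>2 * ln (s / norm x)" using x by (intro mult_nonneg_nonneg ln_ge_zero) auto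
  have add: "enn2real u \<le> enn2real v + w" if "u \<le> v + ennreal w" "v < \<infinity>" "0 \<le> w" for u v w
  proof -
    have "enn2real u \<le> enn2real (v + ennreal w)" using that by (intro enn2real_mono) (auto simp: less_top)
    also have "\<dots> = enn2real v + w" using that by (subst enn2real_plus) (auto simp: less_top)
    finally show ?thesis .
  qed
  have "enn2real (tail s) \<le> enn2real (tail (norm x))"
    using f x by (intro enn2real_mono tail_antimono) auto
  also have "\<dots> \<le> enn2real (sq x) + Q\<^sup>2 * E" by (rule add[OF sq_tail_compare(2)[OF x(1)] f(1) QE])
  finally have 1: "enn2real (tail s) \<le> enn2real (sq x) + Q\<^sup>2 * E" .
  have "enn2real (sq x) \<le> enn2real (tail (norm x)) + Q\<^sup>2 * E" by (rule add[OF sq_tail_compare(1)[OF x(1)] f(2) QE])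
  moreover have "enn2real (tail (norm x)) \<le> enn2real (tail s) + Q\<^sup>2 * ln (s / norm x)"
    using x by (intro add[OF tail_log f(3) l]) auto
  ultimately show "enn2real (tail s) - Q\<^sup>2 * E \<le> enn2real (sq x) \<and>
      enn2real (sq x) \<le> enn2real (tail s) - Q\<^sup>2 * E + Q\<^sup>2 * (2 * E + ln (s / norm x))"
    using 1 by (simp add: algebra_simps)
qed

text \<open>For the square root, put \<open>u = 2 + ln (s / norm x)\<close>. As
  \<open>u >= 1\<close>, the excess \<open>Q^2 (E + 1) u\<close> may be raised to
  \<open>Q^2 (E + 1) u^2\<close>, and subadditivity of \<open>sqrt\<close> then leaves an excess
  linear in \<open>u\<close>, so \<open>BLO_boundI\<close> applies again.\<close>

lemma sq_BLO:
  assumes fin: "tail 1 \<noteq> \<infinity>"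
  shows "BLO_bound (\<lambda>x. enn2real (sq x)) (Q\<^sup>2 * (E + 1) * (2 + 4 * 4 ^ DIM('a)))" (is ?A)
    and "BLO_bound (\<lambda>x. sqrt (enn2real (sq x))) (Q * sqrt (E + 1) * (2 + 4 * 4 ^ DIM('a)))" (is ?B)
proof -
  have osc: "\<exists>a. \<forall>x. x \<noteq> 0 \<longrightarrow> norm x < s \<longrightarrow> a \<le> enn2real (sq x) \<and>
      enn2real (sq x) \<le> a + Q\<^sup>2 * (E + 1) * (2 + ln (s / norm x)) \<and> 0 \<le> ln (s / norm x)" if s: "0 < s" for s
  proof -
    obtain a where a: "\<And>x. x \<noteq> 0 \<Longrightarrow> norm x < s \<Longrightarrow>
      a \<le> enn2real (sq x) \<and> enn2real (sq x) \<le> a + Q\<^sup>2 * (2 * E + ln (s / norm x))"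
      by (rule sq_oscillation[OF fin s]) (rule that)
    show ?thesis
    proof (intro exI allI impI conjI)
      fix x :: 'a assume x: "x \<noteq> 0" "norm x < s"
      show "a \<le> enn2real (sq x)" using a[OF x] by blast
      show l: "0 \<le> ln (s / norm x)" using x by (intro ln_ge_zero) auto
      have "0 \<le> E * ln (s / norm x)" using l E_pos by simp
      then have "Q\<^sup>2 * (2 * E + ln (s / norm x)) \<le> Q\<^sup>2 * ((E + 1) * (2 + ln (s / norm x)))"
        by (intro mult_left_mono) (auto simp: algebra_simps)
      then show "enn2real (sq x) \<le> a + Q\<^sup>2 * (E + 1) * (2 + ln (s / norm x))"
        using a[OF x] by (simp add: mult.assoc)
    qed
  qed
  show ?A
  proof (rule BLO_boundI[OF sq_measurable])
    show "0 \<le> Q\<^sup>2 * (E + 1)" using E_pos by simp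
  qed (use osc in blast)
  show ?B
  proof (rule BLO_boundI)
    show "(\<lambda>x. sqrt (enn2real (sq x))) \<in> borel_measurable borel" using sq_measurable by measurable
    show "0 \<le> Q * sqrt (E + 1)" using E_pos Q by simp
    fix s :: real assume s: "0 < s"
    from osc[OF s] obtain a where a: "\<forall>x. x \<noteq> 0 \<longrightarrow> norm x < s \<longrightarrow> a \<le> enn2real (sq x) \<and>
      enn2real (sq x) \<le> a + Q\<^sup>2 * (E + 1) * (2 + ln (s / norm x)) \<and> 0 \<le> ln (s / norm x)" by blast
    show "\<exists>a. \<forall>x. x \<noteq> 0 \<longrightarrow> norm x < s \<longrightarrow> a \<le> sqrt (enn2real (sq x)) \<and>
      sqrt (enn2real (sq x)) \<le> a + Q * sqrt (E + 1) * (2 + ln (s / norm x))"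
    proof (intro exI allI impI conjI)
      fix x :: 'a assume x: "x \<noteq> 0" "norm x < s"
      \<comment> \<open>\<open>a\<close> may be negative; its positive part is still a lower bound,
        and the root of it is defined.\<close>
      let ?h = "enn2real (sq x)" and ?u = "2 + ln (s / norm x)" and ?a = "max a 0"
      have ax: "a \<le> ?h" "?h \<le> a + Q\<^sup>2 * (E + 1) * ?u" "1 \<le> ?u" using a x by auto
      show "sqrt ?a \<le> sqrt ?h" using ax by simp
      have "?h \<le> ?a + Q\<^sup>2 * (E + 1) * ?u" using ax by linarith
      also have "Q\<^sup>2 * (E + 1) * ?u \<le> Q\<^sup>2 * (E + 1) * ?u\<^sup>2"
        using ax(3) E_pos self_le_power[of ?u 2] by (intro mult_left_mono) auto
      finally have "sqrt ?h \<le> sqrt (?a + Q\<^sup>2 * (E + 1) * ?u\<^sup>2)" by simp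
      also have "\<dots> \<le> sqrt ?a + sqrt (Q\<^sup>2 * (E + 1) * ?u\<^sup>2)"
        using E_pos by (intro sqrt_add_le_add_sqrt) auto
      also have "sqrt (Q\<^sup>2 * (E + 1) * ?u\<^sup>2) = Q * sqrt (E + 1) * ?u"
        using Q ax(3) by (simp add: real_sqrt_mult)
      finally show "sqrt ?h \<le> sqrt ?a + Q * sqrt (E + 1) * ?u" by simp
    qed
  qed
qed

end

section \<open>Both norm bounds, with a constant independent of \<open>f\<close>\<close>

theorem theorem5p6:
  fixes K :: "'a::euclidean_space \<Rightarrow> (nat \<Rightarrow> 'a) \<Rightarrow> real" and m :: nat
  assumes "2 \<le> m" and "LP_kernel m K" and "g_bounded m K"
  shows "\<exists>C. \<forall>f :: nat \<Rightarrow> 'a \<Rightarrow> real. (\<forall>i<m. in_BMO (f i)) \<longrightarrow>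
           ((\<forall>x. LP_g m K f x = \<infinity>) \<or>
            ((AE x in lborel. LP_g m K f x \<noteq> \<infinity>) \<and>
               in_BLO (\<lambda>x. (enn2real (LP_g m K f x))\<^sup>2) \<and>
               BLO_norm (\<lambda>x. (enn2real (LP_g m K f x))\<^sup>2) \<le> C * (\<Prod>i<m. (BMO_norm (f i))\<^sup>2) \<and>
               in_BLO (\<lambda>x. enn2real (LP_g m K f x)) \<and>
               BLO_norm (\<lambda>x. enn2real (LP_g m K f x)) \<le> C * (\<Prod>i<m. BMO_norm (f i))))"
proof -
  have m: "0 < m" using assms(1) by simp
  obtain A d b where A: "0 < A" and d: "0 < d" and b: "0 < b"
    and G1: "\<And>f x t. (\<And>i. i < m \<Longrightarrow> in_BMO (f i)) \<Longrightarrow> 0 < t \<Longrightarrow>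
       \<bar>LP_G m K t f x\<bar> \<le> A * (t / (t + norm x)) powr d * (\<Prod>i<m. BMO_norm (f i))"
    and G2: "\<And>f x t. (\<And>i. i < m \<Longrightarrow> in_BMO (f i)) \<Longrightarrow> 0 < norm x \<Longrightarrow> norm x \<le> t \<Longrightarrow>
       \<bar>LP_G m K t f x - LP_G m K t f 0\<bar> \<le> A * (norm x / t) powr b * (\<Prod>i<m. BMO_norm (f i))"
    using LP_G_bounds[OF assms(2) m] by blast
  define E where "E = 1 / (2 * d) + 2 / b"
  define D where "D = (2 + 4 * 4 ^ DIM('a) :: real)"
  define C1 where "C1 = A\<^sup>2 * (E + 1) * D"
  define C2 where "C2 = A * sqrt (E + 1) * D"
  have E: "0 < E" using d b by (simp add: E_def add_pos_pos)
  have C0: "0 \<le> C1" "0 \<le> C2" using A E by (auto simp: C1_def C2_def D_def)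
  show ?thesis
  proof (intro exI[of _ "C1 + C2"] allI impI)
    fix f :: "nat \<Rightarrow> 'a \<Rightarrow> real" assume "\<forall>i<m. in_BMO (f i)"
    then have f: "\<And>i. i < m \<Longrightarrow> in_BMO (f i)" by blast
    let ?P = "\<Prod>i<m. BMO_norm (f i)"
    let ?F = "\<lambda>x. enn2real (LP_g m K f x)"
    have P: "0 \<le> ?P" using f BMO_norm_nonneg by (intro prod_nonneg) auto
    \<comment> \<open>Holds also where \<open>LP_g\<close> is infinite, since
      \<open>enn2real\<close> of infinity is 0.\<close>
    have F: "?F x = sqrt (enn2real (LP_g_sq m K f x))" for x by (simp add: LP_g_def)
    have F2: "(?F x)\<^sup>2 = enn2real (LP_g_sq m K f x)" for x by (simp add: F)
    \<comment> \<open>The locale wants \<open>Q > 0\<close>, but \<open>?P\<close> vanishes for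
      instance when some \<open>f i\<close> is constant. So \<open>Q = A * p\<close> is taken with
      \<open>p\<close> above \<open>?P\<close>, and \<open>p\<close> tends to \<open>?P\<close> at
      the end.\<close>
    have S: "square_function (\<lambda>t x. LP_G m K t f x) (A * p) d b" if p: "?P < p" for p
    proof
      show "(\<lambda>(t, x). LP_G m K t f x) \<in> borel_measurable (borel \<Otimes>\<^sub>M borel)"
        by (intro LP_G_measurable assms in_BMO_measurable f)
      show "0 < A * p" using A P p by simp
      show "0 < d" "0 < b" by fact+
      fix t :: real and x :: 'a
      have le: "A * w * ?P \<le> A * p * w" if "0 \<le> w" for w
        using mult_left_mono[of ?P p "A * w"] A p that by (simp add: mult_ac)
      show "\<bar>LP_G m K t f x\<bar> \<le> A * p * (t / (t + norm x)) powr d" if "0 < t"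
        by (rule order_trans[OF G1[OF f that] le]) auto
      show "\<bar>LP_G m K t f x - LP_G m K t f 0\<bar> \<le> A * p * (norm x / t) powr b" if "0 < norm x" "norm x \<le> t"
        by (rule order_trans[OF G2[OF f that] le]) auto
    qed
    \<comment> \<open>Any admissible \<open>p\<close> serves for the dichotomy, as \<open>sq\<close>
      and \<open>tail\<close> do not depend on \<open>Q\<close>.\<close>
    interpret S1: square_function "\<lambda>t x. LP_G m K t f x" "A * (?P + 1)" d b by (rule S) simp
    have sq: "LP_g_sq m K f = S1.sq" by (auto simp: LP_g_sq_def S1.sq_def)
    show "(\<forall>x. LP_g m K f x = \<infinity>) \<or>
            ((AE x in lborel. LP_g m K f x \<noteq> \<infinity>) \<and>
               in_BLO (\<lambda>x. (?F x)\<^sup>2) \<and>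
               BLO_norm (\<lambda>x. (?F x)\<^sup>2) \<le> (C1 + C2) * (\<Prod>i<m. (BMO_norm (f i))\<^sup>2) \<and>
               in_BLO ?F \<and>
               BLO_norm ?F \<le> (C1 + C2) * ?P)"
    proof (cases "S1.tail 1 = \<infinity>")
      case True
      then have "LP_g m K f x = \<infinity>" for x using S1.tail_infinite[of x] by (simp add: LP_g_def sq)
      then show ?thesis by blast
    next
      case False
      have bound: "BLO_bound (\<lambda>x. (?F x)\<^sup>2) (C1 * p\<^sup>2) \<and> BLO_bound ?F (C2 * p)" if p: "?P < p" for p
      proof -
        interpret S2: square_function "\<lambda>t x. LP_G m K t f x" "A * p" d b by (rule S[OF p])
        have eq: "(A * p)\<^sup>2 * (S2.E + 1) * (2 + 4 * 4 ^ DIM('a)) = C1 * p\<^sup>2"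
          "A * p * sqrt (S2.E + 1) * (2 + 4 * 4 ^ DIM('a)) = C2 * p"
          by (simp_all add: C1_def C2_def D_def E_def S2.E_def power_mult_distrib)
        have "S2.tail 1 \<noteq> \<infinity>" using False by (simp add: S1.tail_def S2.tail_def)
        from S2.sq_BLO[OF this, unfolded eq] show ?thesis
          unfolding F2 F sq S1.sq_def S2.sq_def by simp
      qed
      have ae: "AE x in lborel. LP_g m K f x \<noteq> \<infinity>"
        using AE_lborel_singleton[of "0::'a"]
      proof eventually_elim
        case (elim x)
        show ?case using S1.sq_finite[OF False elim] by (simp add: LP_g_def sq less_top)
      qed
      \<comment> \<open>The left side is free of \<open>p\<close>, so \<open>p\<close> can decrease
        to \<open>?P\<close>.\<close>
      have n1: "BLO_norm (\<lambda>x. (?F x)\<^sup>2) \<le> C1 * ?P\<^sup>2"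
      proof (rule tendsto_lowerbound)
        show "((\<lambda>p. C1 * p\<^sup>2) \<longlongrightarrow> C1 * ?P\<^sup>2) (at_right ?P)" by (intro tendsto_intros)
        show "\<forall>\<^sub>F p in at_right ?P. BLO_norm (\<lambda>x. (?F x)\<^sup>2) \<le> C1 * p\<^sup>2"
          using eventually_at_right_less[of ?P] by eventually_elim (use bound BLO_norm_le in blast)
      qed simp
      have n2: "BLO_norm ?F \<le> C2 * ?P"
      proof (rule tendsto_lowerbound)
        show "((\<lambda>p. C2 * p) \<longlongrightarrow> C2 * ?P) (at_right ?P)" by (intro tendsto_intros)
        show "\<forall>\<^sub>F p in at_right ?P. BLO_norm ?F \<le> C2 * p"
          using eventually_at_right_less[of ?P] by eventually_elim (use bound BLO_norm_le in blast)
      qed simp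
      have "C1 * ?P\<^sup>2 \<le> (C1 + C2) * ?P\<^sup>2" "C2 * ?P \<le> (C1 + C2) * ?P"
        using C0 P by (auto intro!: mult_right_mono)
      then have "BLO_norm (\<lambda>x. (?F x)\<^sup>2) \<le> (C1 + C2) * ?P\<^sup>2" "BLO_norm ?F \<le> (C1 + C2) * ?P"
        using n1 n2 by linarith+
      moreover have "?P\<^sup>2 = (\<Prod>i<m. (BMO_norm (f i))\<^sup>2)" by (rule prod_power_distrib)
      moreover have "in_BLO (\<lambda>x. (?F x)\<^sup>2)" "in_BLO ?F"
        using bound[of "?P + 1"] by (auto simp: in_BLO_def)
      ultimately show ?thesis using ae by (simp only: simp_thms)
    qed
  qed
qed

end
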